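(* Let $A\in\mathbb{R}^{n\times n}$ and $C_i\in\mathbb{R}^{s_i\times n}$, $i\in\mathbf{m}=\{1,\dots,m\}$, $m>1$, and suppose the system $\dot x=Ax$, $y_i=C_ix$ is jointly observable. Let $\mathcal{P}$ be a finite index set and, for each $p\in\mathcal{P}$, let $\mathbb{N}(p)$ be a strongly connected directed graph on the vertex set $\mathbf{m}$ with a self-loop at each vertex. Let $\tau_D>0$ and $\lambda>0$ be given. Then there exist matrices $K_i\in\mathbb{R}^{n\times s_i}$, $i\in\mathbf{m}$, and a number $g_0>0$ such that for every $g\ge g_0$ there is a constant $c>0$ with the following property: for every switching signal $\sigma\in\mathcal{S}(\tau_D)$, every initial state $x(0)$ and every initial estimator states $x_i(0)$, the solutions of the system and of the distributed observer $$\dot{x}_i = (A+K_iC_i)x_i -K_iy_i -gP_i\Big(x_i-\frac{1}{m_i(\sigma(t))}\sum_{j\in\mathcal{N}_i(\sigma(t))} x_j\Big),\quad i\in\mathbf{m},$$ satisfy $\|e(t)\|\le c\,e^{-\lambda t}\|e(0)\|$ for all $t\ge0$, where $e=\mathrm{column}\{x_1-x,\dots,x_m-x\}$. In particular each $x_i(t)-x(t)$ converges to zero at least as fast as $e^{-\lambda t}$.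
   Context: Joint observability means the pair $(C,A)$ with $C=[C_1'\ \cdots\ C_m']'$ is observable, equivalently $\bigcap_{i}\mathcal{V}_i=0$, where $\mathcal{V}_i$ is the unobservable subspace of $(C_i,A)$ (the largest $A$-invariant subspace contained in $\ker C_i$). $P_i$ denotes the orthogonal projection onto $\mathcal{V}_i$. For $p\in\mathcal{P}$, $\mathcal{N}_i(p)$ is the set of $j$ such that there is an arc from $j$ to $i$ in $\mathbb{N}(p)$ (so $i\in\mathcal{N}_i(p)$), and $m_i(p)$ is the number of elements of $\mathcal{N}_i(p)$. A switching signal is a piecewise-constant, right-continuous map $\sigma:[0,\infty)\to\mathcal{P}$ with finitely many discontinuities on each bounded interval; $\mathcal{S}(\tau_D)$ is the set of switching signals whose consecutive discontinuity times $t_1<t_2<\cdots$ (with $t_0=0$) satisfy $t_{k+1}-t_k\ge\tau_D$ for all $k\ge0$ (dwell time $\tau_D$). $g>0$ is a scalar gain. *)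

theory Defs
  imports "HOL-Analysis.Analysis"
begin

text \<open>Output map of C_i (rows C i 0, ..., C i (s-1), each a vector in R^n):
  y = C_i v as a function nat => real supported on {..<s}.\<close>
definition outp :: "(nat \<Rightarrow> real^'n) \<Rightarrow> nat \<Rightarrow> real^'n \<Rightarrow> (nat \<Rightarrow> real)" where
  "outp Ci s v = (\<lambda>r. if r < s then Ci r \<bullet> v else 0)"

text \<open>Gain K_i in R^{n x s} (columns K i 0, ..., K i (s-1)) applied to w in R^s.\<close>
definition gain :: "(nat \<Rightarrow> real^'n) \<Rightarrow> nat \<Rightarrow> (nat \<Rightarrow> real) \<Rightarrow> real^'n" where
  "gain Ki s w = (\<Sum>r<s. w r *\<^sub>R Ki r)"

text \<open>Unobservable subspace of (C_i, A): largest A-invariant subspace contained in ker C_i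
  (the span of the union of all such subspaces, which is itself one of them).\<close>
definition unobs :: "real^'n^'n \<Rightarrow> (nat \<Rightarrow> real^'n) \<Rightarrow> nat \<Rightarrow> (real^'n) set" where
  "unobs A Ci s = span (\<Union> {V. subspace V \<and> (\<forall>v\<in>V. A *v v \<in> V) \<and> (\<forall>v\<in>V. outp Ci s v = (\<lambda>_. 0))})"

text \<open>Orthogonal projection onto a subspace V.\<close>
definition orth_proj :: "('a::real_inner) set \<Rightarrow> 'a \<Rightarrow> 'a" where
  "orth_proj V x = (THE p. p \<in> V \<and> (\<forall>v\<in>V. (x - p) \<bullet> v = 0))"

text \<open>Neighbour set N_i(p) and its cardinality m_i(p); arcs are pairs (j,i) meaning j -> i.\<close>
definition nbrs :: "(nat \<times> nat) set \<Rightarrow> nat \<Rightarrow> nat set" where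
  "nbrs E i = {j. (j, i) \<in> E}"

definition strongly_connected_sl :: "nat \<Rightarrow> (nat \<times> nat) set \<Rightarrow> bool" where
  "strongly_connected_sl m E \<longleftrightarrow>
     E \<subseteq> {1..m} \<times> {1..m} \<and> (\<forall>i\<in>{1..m}. (i, i) \<in> E) \<and>
     (\<forall>i\<in>{1..m}. \<forall>j\<in>{1..m}. (i, j) \<in> E\<^sup>*)"

text \<open>t > 0 is a discontinuity (switching time) of sigma.\<close>
definition switch_at :: "(real \<Rightarrow> 'p) \<Rightarrow> real \<Rightarrow> bool" where
  "switch_at \<sigma> t \<longleftrightarrow> \<not> (\<exists>\<epsilon>>0. \<forall>s\<in>{t-\<epsilon><..t}. \<sigma> s = \<sigma> t)"

text \<open>Switching signals in S(tau_D) with values in P (considered on [0,oo)):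
  right-continuous piecewise constant, finitely many discontinuities on bounded intervals,
  and consecutive discontinuity times (with t_0 = 0) at least tau_D apart.\<close>
definition dwell_signals :: "'p set \<Rightarrow> real \<Rightarrow> (real \<Rightarrow> 'p) set" where
  "dwell_signals P \<tau> = {\<sigma>.
     (\<forall>t\<ge>0. \<sigma> t \<in> P) \<and>
     (\<forall>t\<ge>0. \<exists>\<epsilon>>0. \<forall>s\<in>{t..<t+\<epsilon>}. \<sigma> s = \<sigma> t) \<and>
     (\<forall>T. finite {t\<in>{0<..T}. switch_at \<sigma> t}) \<and>
     (\<forall>t>0. switch_at \<sigma> t \<longrightarrow> t \<ge> \<tau>) \<and>
     (\<forall>t t'. 0 < t \<and> t < t' \<and> switch_at \<sigma> t \<and> switch_at \<sigma> t' \<longrightarrow> t' - t \<ge> \<tau>)}"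

text \<open>Norm of the stacked error e = column{x_1 - x, ..., x_m - x}.\<close>
definition err_norm :: "nat \<Rightarrow> (nat \<Rightarrow> real^'n) \<Rightarrow> real^'n \<Rightarrow> real" where
  "err_norm m xs x = sqrt (\<Sum>i\<in>{1..m}. (norm (xs i - x))\<^sup>2)"

end

theory Submission
  imports Defs
begin

text \<open>Split the error \<open>e\<^sub>i = x\<^sub>i - x\<close> into its component \<open>z\<^sub>i = P\<^sub>i e\<^sub>i\<close> in the unobservable subspace and the rest.
  The consensus term lies in the unobservable subspace, so it does not enter a Lyapunov function that
  vanishes exactly there. Such a function and a matching gain \<open>K\<^sub>i\<close> come from a finite sum of squares
  satisfying a Lyapunov inequality, which gives any decay rate for \<open>e\<^sub>i - z\<^sub>i\<close>. The components \<open>z\<^sub>i\<close> obey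
  \<open>z\<^sub>i' = d\<^sub>i - g (z\<^sub>i - (S\<^sub>p z)\<^sub>i)\<close>, where \<open>(S\<^sub>p z)\<^sub>i = P\<^sub>i (average of the z\<^sub>j over the neighbours j)\<close>. By strict
  convexity of the Euclidean ball, strong connectivity and joint observability, some power of \<open>S\<^sub>p\<close> is a strict
  contraction in the maximum norm, so \<open>S\<^sub>p\<close> contracts in an equivalent norm that depends on \<open>p\<close>. For large
  \<open>g\<close> this norm decays fast enough on every dwell interval to compensate the change of norm at the next switch.\<close>

subsection \<open>Right Dini derivatives and orthogonal projections\<close>

text \<open>Averaging over in-neighbours is row stochastic but need not be doubly stochastic, so it
  can expand the stacked Euclidean norm. It never expands the maximum over agents of Euclidean
  norms, and neither does a blockwise orthogonal projection. This leads to norms that are not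
  differentiable, along trajectories with only right derivatives at switching times; hence the right
  Dini derivatives. The Lyapunov function of agent \<open>i\<close> does not see vectors of its
  unobservable subspace, so the gains are chosen before the graphs, the signal and \<open>g\<close>.
  The observable parts then force the \<open>z\<close> components with a strength that grows with
  \<open>g\<close>, which is why \<open>c\<close> depends on \<open>g\<close>. The forcing only
  decays like \<open>exp (- lam * t)\<close>; the unforced \<open>z\<close> dynamics is made to
  decay at the strictly larger rate \<open>lam + nu\<close>, so no polynomial factor
  appears.\<close>

text \<open>After tilting by a slope \<open>\<epsilon>\<close>, the set of good times is closed, and
  an initial good segment that ends before \<open>b\<close> can always be prolonged to the right, so
  it reaches \<open>b\<close>. Then \<open>\<epsilon>\<close> tends to zero.\<close>

lemma right_dini_nonincreasing:
  fixes \<phi> :: "real \<Rightarrow> real"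
  assumes "a \<le> b" and cont: "continuous_on {a..b} \<phi>"
    and dini: "\<And>t \<epsilon>. a \<le> t \<Longrightarrow> t < b \<Longrightarrow> 0 < \<epsilon> \<Longrightarrow> \<forall>\<^sub>F s in at_right t. \<phi> s \<le> \<phi> t + \<epsilon> * (s - t)"
  shows "\<phi> b \<le> \<phi> a"
proof -
  have bound: "\<phi> b \<le> \<phi> a + \<epsilon> * (b - a)" if "\<epsilon> > 0" for \<epsilon>
  proof -
    define G where "G = {t \<in> {a..b}. \<phi> t - \<epsilon> * (t - a) \<le> \<phi> a}"
    define S where "S = {t \<in> {a..b}. {a..t} \<subseteq> G}"
    have "closed G"
      unfolding G_def by (intro continuous_on_closed_Collect_le continuous_intros cont)
    have aS: "a \<in> S" using \<open>a \<le> b\<close> by (auto simp: S_def G_def)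
    have bdd: "bdd_above S" by (intro bdd_aboveI[of _ b]) (simp add: S_def)
    define c where "c = Sup S"
    have "a \<le> c" unfolding c_def by (rule cSup_upper[OF aS bdd])
    moreover have "c \<le> b" unfolding c_def
    proof (rule cSup_least)
      show "S \<noteq> {}" using aS by blast
    qed (simp add: S_def)
    ultimately have c: "a \<le> c" "c \<le> b" .
    have lessc: "t \<in> G" if t: "a \<le> t" "t < c" for t
    proof -
      obtain u where "u \<in> S" "t < u" using t(2) less_cSup_iff[OF _ bdd, of t] aS by (auto simp: c_def)
      then show ?thesis using t by (auto simp: S_def)
    qed
    have "c \<in> G"
    proof (cases "a = c")
      case True then show ?thesis using \<open>a \<le> b\<close> by (auto simp: G_def)
    next
      case False
      then have "{a<..<c} \<subseteq> G" "closure {a<..<c} = {a..c}" using c lessc by auto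
      then show ?thesis using \<open>closed G\<close> closure_minimal[of "{a<..<c}" G] c by auto
    qed
    have "c = b"
    proof (rule ccontr)
      assume "c \<noteq> b"
      with c have "c < b" by simp
      from dini[OF c(1) this \<open>\<epsilon> > 0\<close>]
      obtain d where d: "d > c" "\<And>s. s > c \<Longrightarrow> s < d \<Longrightarrow> \<phi> s \<le> \<phi> c + \<epsilon> * (s - c)"
        unfolding eventually_at_right_field by auto
      define e where "e = min b ((c + d) / 2)"
      have e: "c < e" "e \<le> b" "e < d" using \<open>c < b\<close> d(1) by (auto simp: e_def min_def)
      have "t \<in> G" if "a \<le> t" "t \<le> e" for t
      proof (cases "t \<le> c")
        case True then show ?thesis using lessc that \<open>c \<in> G\<close> by (cases "t = c") auto
      next
        case False
        then have "\<phi> t \<le> \<phi> c + \<epsilon> * (t - c)" using d(2) that e by auto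
        moreover have "\<phi> c - \<epsilon> * (c - a) \<le> \<phi> a" using \<open>c \<in> G\<close> by (simp add: G_def)
        ultimately have "\<phi> t - \<epsilon> * (t - a) \<le> \<phi> a" by (simp add: algebra_simps)
        then show ?thesis using that e by (auto simp: G_def)
      qed
      then have "e \<in> S" using e c by (auto simp: S_def)
      then show False using cSup_upper[OF _ bdd, of e] e by (simp add: c_def)
    qed
    then show ?thesis using \<open>c \<in> G\<close> by (auto simp: G_def)
  qed
  show ?thesis
  proof (rule field_le_epsilon)
    fix \<epsilon> :: real assume "\<epsilon> > 0"
    \<comment> \<open>The summand \<open>1\<close> keeps the denominator positive when
      \<open>a = b\<close>.\<close>
    define \<eta> where "\<eta> = \<epsilon> / (b - a + 1)"
    have "\<eta> > 0" using \<open>\<epsilon> > 0\<close> \<open>a \<le> b\<close> by (simp add: \<eta>_def)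
    have "\<eta> * (b - a) \<le> \<epsilon>"
      using \<open>\<epsilon> > 0\<close> \<open>a \<le> b\<close> by (simp add: \<eta>_def field_simps)
    then show "\<phi> b \<le> \<phi> a + \<epsilon>" using bound[OF \<open>\<eta> > 0\<close>] by linarith
  qed
qed

lemma has_right_derivative_imp_le:
  fixes f :: "real \<Rightarrow> real"
  assumes "(f has_real_derivative D) (at t within {t..})" and "D < \<epsilon>"
  shows "\<forall>\<^sub>F s in at_right t. f s \<le> f t + \<epsilon> * (s - t)"
proof -
  have "at t within {t..} = at_right t"
    by (simp add: at_within_Ici_at_right)
  then have "((\<lambda>s. (f s - f t) / (s - t)) \<longlongrightarrow> D) (at_right t)"
    using assms(1) by (simp add: has_field_derivative_iff)
  then have "\<forall>\<^sub>F s in at_right t. (f s - f t) / (s - t) < \<epsilon>"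
    using assms(2) by (rule order_tendstoD)
  moreover have "\<forall>\<^sub>F s in at_right t. s > t"
    by (simp add: eventually_at_right_less)
  ultimately show ?thesis
    by eventually_elim (simp add: field_simps)
qed

lemma right_derivative_nonpos_imp_le:
  fixes f :: "real \<Rightarrow> real"
  assumes "a \<le> b" "continuous_on {a..b} f"
    and "\<And>t. a \<le> t \<Longrightarrow> t < b \<Longrightarrow> \<exists>D\<le>0. (f has_real_derivative D) (at t within {t..})"
  shows "f b \<le> f a"
proof (rule right_dini_nonincreasing[OF assms(1,2)])
  fix t \<epsilon> :: real assume "a \<le> t" "t < b" "0 < \<epsilon>"
  with assms(3) obtain D where "D < \<epsilon>" "(f has_real_derivative D) (at t within {t..})"
    by (meson le_less_trans)
  then show "\<forall>\<^sub>F s in at_right t. f s \<le> f t + \<epsilon> * (s - t)"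
    by (intro has_right_derivative_imp_le)
qed

lemma has_vector_derivative_right_eventually:
  assumes "(z has_vector_derivative v) (at t within {t..})" and "\<epsilon> > 0"
  shows "\<forall>\<^sub>F s in at_right t. norm (z s - (z t + (s - t) *\<^sub>R v)) \<le> \<epsilon> * (s - t)"
proof -
  have "\<exists>d>0. \<forall>s\<in>{t..}. norm (s - t) < d \<longrightarrow> norm (z s - z t - (s - t) *\<^sub>R v) \<le> \<epsilon> * norm (s - t)"
    using assms(1)[unfolded has_vector_derivative_def has_derivative_within_alt, THEN conjunct2,
        rule_format, OF assms(2)] .
  then obtain d where "d > 0" and d: "\<And>s. s \<in> {t..} \<Longrightarrow> norm (s - t) < d \<Longrightarrow>
      norm (z s - z t - (s - t) *\<^sub>R v) \<le> \<epsilon> * norm (s - t)"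
    by blast
  show ?thesis
    unfolding eventually_at_right_field
  proof (intro exI[of _ "t + d"] conjI allI impI)
    fix s assume "t < s" "s < t + d"
    then show "norm (z s - (z t + (s - t) *\<^sub>R v)) \<le> \<epsilon> * (s - t)"
      using d[of s] by (simp add: algebra_simps)
  qed (use \<open>d > 0\<close> in simp)
qed

section \<open>Orthogonal projections onto subspaces\<close>

lemma orth_proj_unique_exists:
  fixes V :: "'a::euclidean_space set"
  assumes "subspace V"
  shows "\<exists>!p. p \<in> V \<and> (\<forall>v\<in>V. (x - p) \<bullet> v = 0)"
proof (rule ex_ex1I)
  obtain y z where "y \<in> span V" and z: "\<And>w. w \<in> span V \<Longrightarrow> orthogonal z w" and x: "x = y + z"
    using orthogonal_subspace_decomp_exists[of V x] by metis
  then show "\<exists>p. p \<in> V \<and> (\<forall>v\<in>V. (x - p) \<bullet> v = 0)"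
    using assms by (intro exI[of _ y]) (auto simp: orthogonal_def span_eq_iff[THEN iffD2])
next
  fix p q
  assume p: "p \<in> V \<and> (\<forall>v\<in>V. (x - p) \<bullet> v = 0)" and q: "q \<in> V \<and> (\<forall>v\<in>V. (x - q) \<bullet> v = 0)"
  then have "p - q \<in> V" using assms by (simp add: subspace_diff)
  then have "(p - q) \<bullet> (p - q) = (x - q) \<bullet> (p - q) - (x - p) \<bullet> (p - q)"
    by (simp add: inner_diff_left)
  also have "\<dots> = 0" using p q \<open>p - q \<in> V\<close> by simp
  finally show "p = q" by simp
qed

lemma orth_proj:
  fixes V :: "'a::euclidean_space set"
  assumes "subspace V"
  shows orth_proj_mem: "orth_proj V x \<in> V"
    and orth_proj_orth: "v \<in> V \<Longrightarrow> (x - orth_proj V x) \<bullet> v = 0"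
  using theI'[OF orth_proj_unique_exists[OF assms, of x]] unfolding orth_proj_def by auto

lemma orth_proj_eqI:
  fixes V :: "'a::euclidean_space set"
  assumes "subspace V" "p \<in> V" "\<And>v. v \<in> V \<Longrightarrow> (x - p) \<bullet> v = 0"
  shows "orth_proj V x = p"
  using orth_proj_unique_exists[OF assms(1), of x] orth_proj_mem[OF assms(1), of x] orth_proj_orth[OF assms(1), of _ x] assms(2,3) by blast

lemma linear_orth_proj:
  fixes V :: "'a::euclidean_space set"
  assumes "subspace V"
  shows "linear (orth_proj V)"
proof (rule linearI)
  fix x y :: 'a and c :: real
  note V = orth_proj_mem[OF assms] orth_proj_orth[OF assms]
  show "orth_proj V (x + y) = orth_proj V x + orth_proj V y"
  proof (rule orth_proj_eqI[OF assms])
    fix v assume "v \<in> V"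
    then show "(x + y - (orth_proj V x + orth_proj V y)) \<bullet> v = 0"
      using V(2)[of v x] V(2)[of v y] by (simp add: algebra_simps inner_diff_left)
  qed (simp add: V assms subspace_add)
  show "orth_proj V (c *\<^sub>R x) = c *\<^sub>R orth_proj V x"
  proof (rule orth_proj_eqI[OF assms])
    fix v assume "v \<in> V"
    then show "(c *\<^sub>R x - c *\<^sub>R orth_proj V x) \<bullet> v = 0"
      using V(2)[of v x] by (simp flip: scaleR_diff_right)
  qed (simp add: V assms subspace_scale)
qed

lemma norm_orth_proj:
  fixes V :: "'a::euclidean_space set"
  assumes "subspace V"
  shows "(norm x)\<^sup>2 = (norm (orth_proj V x))\<^sup>2 + (norm (x - orth_proj V x))\<^sup>2"
proof -
  have "(x - orth_proj V x) \<bullet> orth_proj V x = 0"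
    using orth_proj[OF assms] by blast
  then show ?thesis
    by (simp add: power2_norm_eq_inner inner_diff_left inner_diff_right inner_commute)
qed

lemma norm_orth_proj_le:
  fixes V :: "'a::euclidean_space set"
  assumes "subspace V"
  shows "norm (orth_proj V x) \<le> norm x"
  by (rule power2_le_imp_le) (use norm_orth_proj[OF assms, of x] in auto)

text \<open>Equality case of Pythagoras. It serves to conclude that an average which its projection
  does not shorten already lies in the subspace.\<close>

lemma norm_orth_proj_eq_imp_mem:
  fixes V :: "'a::euclidean_space set"
  assumes "subspace V" "norm x \<le> norm (orth_proj V x)"
  shows "x \<in> V"
proof -
  have "norm x = norm (orth_proj V x)" using assms norm_orth_proj_le[OF assms(1), of x] by simp
  then have "x = orth_proj V x" using norm_orth_proj[OF assms(1), of x] by simp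
  then show ?thesis using orth_proj_mem[OF assms(1)] by metis
qed

subsection \<open>Unobservable subspaces and local gains\<close>

text \<open>Invariance and vanishing output both survive linear combinations, so the span of all
  invariant subspaces in the kernel is again one of them.\<close>

lemma unobs_unobservable:
  assumes "v \<in> unobs A Ci s"
  shows "A *v v \<in> unobs A Ci s \<and> outp Ci s v = (\<lambda>_. 0)"
  using assms unfolding unobs_def
proof (induction rule: span_induct_alt)
  case base
  then show ?case by (simp add: outp_def span_zero fun_eq_iff)
next
  case (step c x y)
  then obtain V where "\<forall>v\<in>V. A *v v \<in> V" "\<forall>v\<in>V. outp Ci s v = (\<lambda>_. 0)" "x \<in> V" "subspace V" by blast
  then have "A *v x \<in> span (\<Union> {V. subspace V \<and> (\<forall>v\<in>V. A *v v \<in> V) \<and> (\<forall>v\<in>V. outp Ci s v = (\<lambda>_. 0))})"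
    and x: "outp Ci s x = (\<lambda>_. 0)"
    by (blast intro: span_base)+
  moreover have "outp Ci s (c *\<^sub>R x + y) = (\<lambda>r. c * outp Ci s x r + outp Ci s y r)"
    by (auto simp: outp_def inner_add_right)
  ultimately show ?case
    using step by (simp add: matrix_vector_right_distrib matrix_vector_mult_scaleR span_add span_scale)
qed

lemma subspace_unobs: "subspace (unobs A Ci s)"
  unfolding unobs_def by (rule subspace_span)

lemma unobs_largest:
  assumes "subspace V" "\<And>v. v \<in> V \<Longrightarrow> A *v v \<in> V" "\<And>v r. v \<in> V \<Longrightarrow> r < s \<Longrightarrow> Ci r \<bullet> v = 0"
  shows "V \<subseteq> unobs A Ci s"
proof -
  have "\<forall>v\<in>V. outp Ci s v = (\<lambda>_. 0)" using assms(3) by (auto simp: outp_def)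
  then show ?thesis unfolding unobs_def using assms(1,2) by (blast intro: span_base)
qed

lemma unobs_output: "v \<in> unobs A Ci s \<Longrightarrow> r < s \<Longrightarrow> Ci r \<bullet> v = 0"
  using unobs_unobservable[of v A Ci s] by (auto simp: outp_def fun_eq_iff split: if_splits)

section \<open>Lyapunov forms vanishing on the unobservable subspace, and the gains they
  yield\<close>

lemma gain_outp: "gain Ki s (outp Ci s v) = (\<Sum>r<s. (Ci r \<bullet> v) *\<^sub>R Ki r)"
  by (simp add: gain_def outp_def)

lemma linear_gain_outp: "linear (\<lambda>v. gain Ki s (outp Ci s v))"
  unfolding gain_outp
  by (intro linear_compose_sum ballI linearI) (simp_all add: inner_add_right scaleR_add_left)

text \<open>With \<open>R = (A + 2\<lambda>)\<^sup>-\<^sup>1\<close> and \<open>F = A R\<close>, the form \<open>w x = \<Sum>k<N. |C R F\<^sup>k x|\<^sup>2\<close> satisfies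
  \<open>w ((A + 2\<lambda>) z) - w (A z) = |C z|\<^sup>2 - |C R F\<^sup>N (A + 2\<lambda>) z|\<^sup>2\<close> by telescoping. The left-hand side is
  four times \<open>\<lambda>\<close> times the bilinear form at \<open>((A + \<lambda>) z, z)\<close>.\<close>
lemma observability_form:
  fixes A :: "real^'n^'n" and c :: "nat \<Rightarrow> real^'n"
  assumes "lam > 0" and big: "\<And>v. norm (A *v v) \<le> lam * norm v"
  obtains J :: "(nat \<times> nat) set" and h :: "nat \<times> nat \<Rightarrow> real^'n" where "finite J"
    "\<And>z. 4 * lam * (\<Sum>j\<in>J. (h j \<bullet> (A *v z + lam *\<^sub>R z)) * (h j \<bullet> z)) \<le> (\<Sum>r<s. (c r \<bullet> z)\<^sup>2)"
    "unobs A c s = {z. \<forall>j\<in>J. h j \<bullet> z = 0}"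
proof -
  define f where "f z = A *v z + (2 * lam) *\<^sub>R z" for z
  have "linear f" unfolding f_def
    by (intro linear_compose_add linear_scale_self matrix_vector_mul_linear)
  \<comment> \<open>The norm bound keeps \<open>- 2 * lam\<close> out of the spectrum of
    \<open>A\<close>.\<close>
  have "z = 0" if "f z = 0" for z
  proof -
    have "norm (A *v z) = 2 * lam * norm z"
      using that \<open>lam > 0\<close> by (simp add: f_def eq_neg_iff_add_eq_0[symmetric])
    with big[of z] \<open>lam > 0\<close> show "z = 0" by simp
  qed
  then have "inj f" using \<open>linear f\<close> by (simp add: linear_injective_0)
  then obtain R where "linear R" and Rf: "\<And>z. R (f z) = z" and fR: "\<And>z. f (R z) = z"
    using linear_injective_isomorphism[OF \<open>linear f\<close>] by auto
  define F where "F z = A *v R z" for z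
  have "linear F" unfolding F_def using \<open>linear R\<close> linear_compose[of R "(*v) A"]
    by (simp add: o_def)
  have linFk: "linear (F ^^ k)" for k
  proof (induction k)
    case (Suc k)
    show ?case using linear_compose[OF Suc \<open>linear F\<close>] by (simp only: funpow.simps)
  qed (simp only: funpow.simps linear_id)
  \<comment> \<open>Each functional \<open>x \<mapsto> c r \<bullet> R ((F ^^ k) x)\<close> is
    represented by a vector, so the form becomes a sum of squares of inner products.\<close>
  define h where "h r k = adjoint (R \<circ> F ^^ k) (c r)" for r k
  have h: "h r k \<bullet> x = c r \<bullet> R ((F ^^ k) x)" for r k x
    using adjoint_works[OF linear_compose[OF linFk \<open>linear R\<close>], of x k "c r"]
    by (simp add: h_def inner_commute)
  have Ff: "F (f z) = A *v z" for z by (simp add: F_def Rf)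
  have hA: "h r k \<bullet> (A *v z) = h r (Suc k) \<bullet> f z" for r k z
    by (simp add: h funpow_swap1 Ff del: funpow.simps(2)) (metis Ff funpow_Suc_right o_apply)
  have hf: "h r k \<bullet> f z = h r k \<bullet> (A *v z) + 2 * lam * (h r k \<bullet> z)" for r k z
    by (simp add: f_def inner_add_right)
  have key: "4 * lam * (\<Sum>k<N. (h r k \<bullet> (A *v z + lam *\<^sub>R z)) * (h r k \<bullet> z)) \<le> (c r \<bullet> z)\<^sup>2" for r N z
  proof -
    have "4 * lam * (\<Sum>k<N. (h r k \<bullet> (A *v z + lam *\<^sub>R z)) * (h r k \<bullet> z))
        = (\<Sum>k<N. (h r k \<bullet> f z)\<^sup>2 - (h r (Suc k) \<bullet> f z)\<^sup>2)"
      unfolding sum_distrib_left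
    proof (rule sum.cong)
      fix k
      show "4 * lam * ((h r k \<bullet> (A *v z + lam *\<^sub>R z)) * (h r k \<bullet> z)) = (h r k \<bullet> f z)\<^sup>2 - (h r (Suc k) \<bullet> f z)\<^sup>2"
        unfolding hA[symmetric] unfolding hf by (simp add: inner_add_right power2_eq_square algebra_simps)
    qed simp
    also have "\<dots> = (h r 0 \<bullet> f z)\<^sup>2 - (h r N \<bullet> f z)\<^sup>2"
      by (rule sum_lessThan_telescope')
    also have "\<dots> \<le> (c r \<bullet> z)\<^sup>2" by (simp add: h Rf)
    finally show ?thesis .
  qed
  define U where "U N = {z. \<forall>r<s. \<forall>k<N. h r k \<bullet> z = 0}" for N
  have subU: "subspace (U N)" for N
    by (auto simp: U_def subspace_def inner_add_right)
  have antiU: "U M \<subseteq> U N" if "N \<le> M" for M N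
    using that by (auto simp: U_def)
  \<comment> \<open>The subspaces \<open>U N\<close> decrease with \<open>N\<close>; at minimal
    dimension the chain is constant from there on. This takes the place of Cayley-Hamilton.\<close>
  obtain N where N: "dim (U N) \<le> dim (U M)" for M
    using ex_has_least_nat[of "\<lambda>_. True" "0::nat" "\<lambda>N. dim (U N)"] by blast
  have UN: "U N \<subseteq> U M" for M
  proof (cases "N \<le> M")
    case True
    then have "U M = U N" by (intro subspace_dim_equal[OF subU subU antiU N])
    then show ?thesis by simp
  qed (use antiU in auto)
  have Uall: "h r k \<bullet> z = 0" if "z \<in> U N" "r < s" for r k z
    using UN[of "Suc k"] that by (auto simp: U_def)
  \<comment> \<open>Since \<open>(A + 2 * lam) R\<close> is the identity, \<open>F\<close> and
    \<open>R\<close> have the same invariant subspaces; shifting the index \<open>k\<close> shows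
    that \<open>U N\<close> is invariant under \<open>F\<close>.\<close>
  have F_alt: "F z = z - (2 * lam) *\<^sub>R R z" for z
    using fR[of z] by (simp add: F_def f_def algebra_simps)
  have RU: "R z \<in> U N" if "z \<in> U N" for z
  proof -
    have "F z \<in> U N"
      using Uall[OF that, of _ "Suc _"] by (auto simp: U_def h funpow_swap1)
    then have "z - F z \<in> U N" using subU that by (simp add: subspace_diff)
    then have "(1 / (2 * lam)) *\<^sub>R (z - F z) \<in> U N" using subU subspace_scale by blast
    then show ?thesis using \<open>lam > 0\<close> by (simp add: F_alt)
  qed
  have "inj R" using fR by (metis injI)
  \<comment> \<open>An injective map of a finite-dimensional space into itself is onto. Writing
    \<open>v = R u\<close> with \<open>u\<close> in \<open>U N\<close> gives
    \<open>A *v v = u - (2 * lam) *\<^sub>R v\<close>, hence invariance under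
    \<open>A\<close>.\<close>
  have imR: "R ` U N = U N"
  proof (rule subspace_dim_equal)
    show "subspace (R ` U N)" using \<open>linear R\<close> subU by (simp add: linear_subspace_image)
    show "dim (U N) \<le> dim (R ` U N)"
      using dim_image_eq[OF \<open>linear R\<close> inj_on_subset[OF \<open>inj R\<close>], of "U N"] by simp
  qed (use RU subU in auto)
  have "U N \<subseteq> unobs A c s"
  proof (rule unobs_largest[OF subU])
    fix v assume "v \<in> U N"
    then obtain u where u: "u \<in> U N" "v = R u" using imR by blast
    have "A *v v = u - (2 * lam) *\<^sub>R v" using F_alt[of u] by (simp add: u F_def)
    then show "A *v v \<in> U N" using u(1) \<open>v \<in> U N\<close> subU by (simp add: subspace_diff subspace_scale)
    show "c r \<bullet> v = 0" if "r < s" for r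
      using Uall[OF u(1) that, of 0] by (simp add: h u)
  qed
  moreover have "unobs A c s \<subseteq> U N"
  proof
    define V where "V = unobs A c s"
    note V = subspace_unobs[of A c s, folded V_def]
    \<comment> \<open>For the converse inclusion, \<open>f\<close> maps \<open>V\<close> injectively
      into itself, hence onto, so its inverse \<open>R\<close> preserves \<open>V\<close> as
      well.\<close>
    have "f v \<in> V" if "v \<in> V" for v
      using that unobs_unobservable[of v A c s] V by (simp add: V_def[symmetric] f_def subspace_add subspace_scale)
    then have "f ` V = V"
      using dim_image_eq[OF \<open>linear f\<close> inj_on_subset[OF \<open>inj f\<close>], of V] V \<open>linear f\<close>
      by (intro subspace_dim_equal linear_subspace_image) auto
    then have RV: "R v \<in> V" if "v \<in> V" for v using that Rf by (metis imageE)
    have FV: "(F ^^ k) v \<in> V" if "v \<in> V" for v k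
      using that RV unobs_unobservable[of _ A c s] by (induction k) (auto simp: F_def V_def)
    fix v assume "v \<in> unobs A c s"
    then show "v \<in> U N"
      using RV[OF FV] unobs_output[of _ A c s] by (auto simp: U_def h V_def)
  qed
  ultimately have "unobs A c s = {z. \<forall>j\<in>{..<s} \<times> {..<N}. case_prod h j \<bullet> z = 0}"
    by (auto simp: U_def)
  moreover have "4 * lam * (\<Sum>j\<in>{..<s} \<times> {..<N}. (case_prod h j \<bullet> (A *v z + lam *\<^sub>R z)) * (case_prod h j \<bullet> z))
      \<le> (\<Sum>r<s. (c r \<bullet> z)\<^sup>2)" for z
  proof -
    have "4 * lam * (\<Sum>r<s. \<Sum>k<N. (h r k \<bullet> (A *v z + lam *\<^sub>R z)) * (h r k \<bullet> z)) \<le> (\<Sum>r<s. (c r \<bullet> z)\<^sup>2)"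
      unfolding sum_distrib_left[of _ _ "{..<s}"] by (intro sum_mono key)
    then show ?thesis by (simp add: sum.cartesian_product case_prod_beta)
  qed
  ultimately show thesis using that[of "{..<s} \<times> {..<N}" "case_prod h"] by blast
qed

text \<open>Split \<open>c\<close> into a vector in the range of the Gram operator \<open>W\<close>
  and a \<open>z\<close> orthogonal to it. Then \<open>z \<bullet> W z = 0\<close> is a sum of
  squares, so \<open>z\<close> lies in the common kernel, is orthogonal to \<open>c\<close>, and
  must vanish. This makes \<open>W x = c\<close> solvable although \<open>W\<close> is singular on
  the unobservable subspace.\<close>

lemma gram_operator_range:
  fixes h :: "'j \<Rightarrow> 'a::euclidean_space"
  assumes "finite J" and c: "\<And>z. (\<forall>j\<in>J. h j \<bullet> z = 0) \<Longrightarrow> c \<bullet> z = 0"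
  shows "\<exists>x. c = (\<Sum>j\<in>J. (h j \<bullet> x) *\<^sub>R h j)"
proof -
  define W where "W x = (\<Sum>j\<in>J. (h j \<bullet> x) *\<^sub>R h j)" for x
  have "linear W" unfolding W_def
    by (intro linear_compose_sum ballI linearI) (simp_all add: inner_add_right scaleR_add_left)
  obtain y z where y: "y \<in> span (range W)" and z: "\<And>w. w \<in> span (range W) \<Longrightarrow> orthogonal z w"
    and c_eq: "c = y + z"
    using orthogonal_subspace_decomp_exists[of "range W" c] by metis
  have "z \<bullet> W z = 0" using z[OF span_base[of "W z"]] by (simp add: orthogonal_def)
  then have "(\<Sum>j\<in>J. (h j \<bullet> z)\<^sup>2) = 0"
    by (simp add: W_def inner_sum_right power2_eq_square inner_commute)
  then have "\<forall>j\<in>J. h j \<bullet> z = 0" using \<open>finite J\<close> by (simp add: sum_nonneg_eq_0_iff)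
  then have "c \<bullet> z = 0" by (rule c)
  moreover have "y \<bullet> z = 0" using z[OF y] by (simp add: orthogonal_def inner_commute)
  ultimately have "z = 0" by (simp add: c_eq inner_add_left)
  moreover have "span (range W) = range W"
    using \<open>linear W\<close> linear_subspace_image[OF _ subspace_UNIV] span_eq_iff by blast
  ultimately have "c \<in> range W" using y c_eq by (simp only: add_0_right)
  then show ?thesis by (auto simp: W_def)
qed

text \<open>The Gram operator \<open>W\<close> is injective on the orthogonal complement
  \<open>Q\<close> of \<open>V\<close>, hence bounded below there, and \<open>W\<close> is in turn
  bounded by the square root of the form.\<close>

lemma gram_form_lower_bound:
  fixes h :: "'j \<Rightarrow> 'a::euclidean_space"
  assumes "finite J"
  defines "V \<equiv> {z. \<forall>j\<in>J. h j \<bullet> z = 0}"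
  obtains b where "b \<ge> 0" "\<And>x. norm (x - orth_proj V x) \<le> b * sqrt (\<Sum>j\<in>J. (h j \<bullet> x)\<^sup>2)"
proof -
  have V: "subspace V" by (auto simp: V_def subspace_def inner_add_right)
  define W where "W x = (\<Sum>j\<in>J. (h j \<bullet> x) *\<^sub>R h j)" for x
  have "linear W" unfolding W_def
    by (intro linear_compose_sum ballI linearI) (simp_all add: inner_add_right scaleR_add_left)
  define Q where "Q = {y. \<forall>v\<in>V. y \<bullet> v = 0}"
  have "subspace Q" by (auto simp: Q_def subspace_def inner_add_left)
  have "\<forall>x\<in>Q. W x = 0 \<longrightarrow> x = 0"
  proof (intro ballI impI)
    fix x assume "x \<in> Q" "W x = 0"
    then have "x \<bullet> W x = 0" by simp
    then have "(\<Sum>j\<in>J. (h j \<bullet> x)\<^sup>2) = 0"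
      by (simp add: W_def inner_sum_right power2_eq_square inner_commute)
    then have "x \<in> V" using \<open>finite J\<close> by (simp add: sum_nonneg_eq_0_iff V_def)
    then show "x = 0" using \<open>x \<in> Q\<close> by (auto simp: Q_def)
  qed
  then obtain e where "e > 0" and e: "\<And>x. x \<in> Q \<Longrightarrow> e * norm x \<le> norm (W x)"
    using injective_imp_isometric[of Q W] \<open>subspace Q\<close> \<open>linear W\<close>
    by (auto simp: closed_subspace linear_conv_bounded_linear)
  define H where "H = (\<Sum>j\<in>J. norm (h j))"
  have "norm (x - orth_proj V x) \<le> H / e * sqrt (\<Sum>j\<in>J. (h j \<bullet> x)\<^sup>2)" for x
  proof -
    let ?y = "x - orth_proj V x"
    have hy: "h j \<bullet> ?y = h j \<bullet> x" if "j \<in> J" for j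
      using orth_proj_mem[OF V, of x] that by (simp add: V_def inner_diff_right)
    have "?y \<in> Q" using orth_proj_orth[OF V] by (simp add: Q_def)
    then have "e * norm ?y \<le> norm (W ?y)" by (rule e)
    also have "\<dots> \<le> (\<Sum>j\<in>J. norm ((h j \<bullet> ?y) *\<^sub>R h j))" unfolding W_def by (rule norm_sum)
    also have "\<dots> \<le> (\<Sum>j\<in>J. sqrt (\<Sum>j\<in>J. (h j \<bullet> x)\<^sup>2) * norm (h j))"
    proof (rule sum_mono)
      fix j assume j: "j \<in> J"
      have "\<bar>h j \<bullet> x\<bar> = sqrt ((h j \<bullet> x)\<^sup>2)" by simp
      also have "\<dots> \<le> sqrt (\<Sum>j\<in>J. (h j \<bullet> x)\<^sup>2)"
        using \<open>finite J\<close> j by (intro real_sqrt_le_mono member_le_sum) auto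
      finally show "norm ((h j \<bullet> ?y) *\<^sub>R h j) \<le> sqrt (\<Sum>j\<in>J. (h j \<bullet> x)\<^sup>2) * norm (h j)"
        by (simp only: hy[OF j] norm_scaleR mult_right_mono norm_ge_zero)
    qed
    finally show ?thesis using \<open>e > 0\<close> by (simp add: H_def sum_distrib_right sum_distrib_left field_simps)
  qed
  moreover have "H / e \<ge> 0" using \<open>e > 0\<close> by (simp add: H_def sum_nonneg)
  ultimately show thesis using that by blast
qed

text \<open>The columns of the gain solve \<open>W (K r) = - c r / (4 * lam)\<close> with the Gram
  operator \<open>W\<close>. Output injection then contributes exactly minus the output energy that
  \<open>observability_form\<close> leaves on the right-hand side.\<close>

lemma observer_gain_exists:
  fixes A :: "real^'n^'n" and c :: "nat \<Rightarrow> real^'n"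
  assumes "lam > 0" and big: "\<And>v. norm (A *v v) \<le> lam * norm v"
  obtains K J and h :: "nat \<times> nat \<Rightarrow> real^'n" where "finite J"
    "unobs A c s = {z. \<forall>j\<in>J. h j \<bullet> z = 0}"
    "\<And>z. (\<Sum>j\<in>J. (h j \<bullet> (A *v z + gain K s (outp c s z))) * (h j \<bullet> z)) \<le> - lam * (\<Sum>j\<in>J. (h j \<bullet> z)\<^sup>2)"
proof -
  obtain J and h :: "nat \<times> nat \<Rightarrow> real^'n" where "finite J"
    and form: "\<And>z. 4 * lam * (\<Sum>j\<in>J. (h j \<bullet> (A *v z + lam *\<^sub>R z)) * (h j \<bullet> z)) \<le> (\<Sum>r<s. (c r \<bullet> z)\<^sup>2)"
    and V: "unobs A c s = {z. \<forall>j\<in>J. h j \<bullet> z = 0}"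
    by (rule observability_form[OF assms, of c s]) (rule that; simp)
  define W where "W x = (\<Sum>j\<in>J. (h j \<bullet> x) *\<^sub>R h j)" for x
  have "\<forall>r\<in>{..<s}. \<exists>x. c r = W x"
    unfolding W_def
    using \<open>finite J\<close> V unobs_output[of _ A c s] by (intro ballI gram_operator_range) auto
  then obtain X where X: "\<And>r. r < s \<Longrightarrow> c r = W (X r)" by (metis lessThan_iff)
  define K where "K r = (- 1 / (4 * lam)) *\<^sub>R X r" for r
  have gain_form: "4 * lam * (\<Sum>j\<in>J. (h j \<bullet> gain K s (outp c s z)) * (h j \<bullet> z)) = - (\<Sum>r<s. (c r \<bullet> z)\<^sup>2)" for z
  proof -
    have Wsym: "(\<Sum>j\<in>J. (h j \<bullet> x) * (h j \<bullet> z)) = W x \<bullet> z" for x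
      by (simp add: W_def inner_sum_left)
    have lin: "linear W" unfolding W_def
      by (intro linear_compose_sum ballI linearI) (simp_all add: inner_add_right scaleR_add_left)
    have "4 * lam * (\<Sum>j\<in>J. (h j \<bullet> gain K s (outp c s z)) * (h j \<bullet> z))
        = (\<Sum>r<s. 4 * lam * ((c r \<bullet> z) * (W (K r) \<bullet> z)))"
      unfolding Wsym gain_outp linear_sum[OF lin]
      by (simp add: linear_scale[OF lin] inner_sum_left sum_distrib_left)
    also have "\<dots> = (\<Sum>r<s. - (c r \<bullet> z)\<^sup>2)"
      using \<open>lam > 0\<close> by (intro sum.cong) (simp_all add: K_def linear_scale[OF lin] X power2_eq_square linear_neg[OF lin])
    finally show ?thesis by (simp add: sum_negf)
  qed
  have "(\<Sum>j\<in>J. (h j \<bullet> (A *v z + gain K s (outp c s z))) * (h j \<bullet> z)) \<le> - lam * (\<Sum>j\<in>J. (h j \<bullet> z)\<^sup>2)" for z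
  proof -
    have "(\<Sum>j\<in>J. (h j \<bullet> (A *v z + lam *\<^sub>R z)) * (h j \<bullet> z))
        = (\<Sum>j\<in>J. (h j \<bullet> (A *v z)) * (h j \<bullet> z)) + lam * (\<Sum>j\<in>J. (h j \<bullet> z)\<^sup>2)"
      by (simp add: inner_add_right algebra_simps sum.distrib sum_distrib_left power2_eq_square)
    moreover have "(\<Sum>j\<in>J. (h j \<bullet> (A *v z + gain K s (outp c s z))) * (h j \<bullet> z))
        = (\<Sum>j\<in>J. (h j \<bullet> (A *v z)) * (h j \<bullet> z)) + (\<Sum>j\<in>J. (h j \<bullet> gain K s (outp c s z)) * (h j \<bullet> z))"
      by (simp add: inner_add_right algebra_simps sum.distrib)
    ultimately have "4 * lam * ((\<Sum>j\<in>J. (h j \<bullet> (A *v z + gain K s (outp c s z))) * (h j \<bullet> z)) + lam * (\<Sum>j\<in>J. (h j \<bullet> z)\<^sup>2)) \<le> 0"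
      using form[of z] gain_form[of z] by (simp add: algebra_simps)
    then show ?thesis using \<open>lam > 0\<close> by (simp add: mult_le_0_iff)
  qed
  then show thesis using that \<open>finite J\<close> V by blast
qed

text \<open>The disturbance \<open>d\<close> is any function with values in \<open>V\<close>, and
  \<open>K\<close>, \<open>b\<close> precede it in the quantifiers. The consensus term can thus be
  inserted later, whatever the graphs, the signal, the gain \<open>g\<close> and the other agents
  do.\<close>

lemma observable_error_decay:
  fixes A :: "real^'n^'n" and c :: "nat \<Rightarrow> real^'n" and s :: nat
  defines "V \<equiv> unobs A c s"
  shows "\<exists>K b. b \<ge> 0 \<and> (\<forall>e d. continuous_on {0..} e \<longrightarrow> (\<forall>t\<ge>0. d t \<in> V) \<longrightarrow>
      (\<forall>t\<ge>0. (e has_vector_derivative (A *v e t + gain K s (outp c s (e t)) + d t)) (at t within {t..})) \<longrightarrow>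
      (\<forall>t\<ge>0. norm (e t - orth_proj V (e t)) \<le> b * exp (- lam * t) * norm (e 0)))"
proof -
  obtain a where "a > 0" and a: "\<And>v. norm (A *v v) \<le> norm v * a"
    using bounded_linear.pos_bounded[OF matrix_vector_mul_bounded_linear[of A]] by blast
  \<comment> \<open>The Lyapunov form needs a rate that dominates the norm of \<open>A\<close>;
    decaying faster than \<open>lam\<close> does no harm.\<close>
  define l where "l = max a lam"
  have "l > 0" "lam \<le> l" using \<open>a > 0\<close> by (auto simp: l_def)
  have big: "norm (A *v v) \<le> l * norm v" for v
    using a[of v] mult_right_mono[of a l "norm v"] by (simp add: l_def mult.commute)
  obtain K J and h :: "nat \<times> nat \<Rightarrow> real^'n" where "finite J"
    and V: "V = {z. \<forall>j\<in>J. h j \<bullet> z = 0}"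
    and K: "\<And>z. (\<Sum>j\<in>J. (h j \<bullet> (A *v z + gain K s (outp c s z))) * (h j \<bullet> z)) \<le> - l * (\<Sum>j\<in>J. (h j \<bullet> z)\<^sup>2)"
    by (rule observer_gain_exists[OF \<open>l > 0\<close> big, of c s]) (rule that; simp add: V_def)
  define w where "w x = (\<Sum>j\<in>J. (h j \<bullet> x)\<^sup>2)" for x
  obtain b where "b \<ge> 0" and b: "\<And>x. norm (x - orth_proj V x) \<le> b * sqrt (w x)"
    using gram_form_lower_bound[OF \<open>finite J\<close>, of h] unfolding V w_def by blast
  define H where "H = sqrt (\<Sum>j\<in>J. (norm (h j))\<^sup>2)"
  have H: "sqrt (w x) \<le> H * norm x" for x
  proof -
    have "w x \<le> (\<Sum>j\<in>J. (norm (h j))\<^sup>2 * (norm x)\<^sup>2)"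
      unfolding w_def
      by (intro sum_mono) (metis Cauchy_Schwarz_ineq2 abs_ge_zero power2_abs power_mono power_mult_distrib)
    then have "sqrt (w x) \<le> sqrt ((\<Sum>j\<in>J. (norm (h j))\<^sup>2) * (norm x)\<^sup>2)"
      by (simp add: sum_distrib_right)
    then show ?thesis by (simp add: H_def real_sqrt_mult)
  qed
  have decay: "norm (e t - orth_proj V (e t)) \<le> b * H * exp (- lam * t) * norm (e 0)"
    if cont: "continuous_on {0..} e" and d: "\<And>t. t \<ge> 0 \<Longrightarrow> d t \<in> V"
      and deriv: "\<And>t. t \<ge> 0 \<Longrightarrow> (e has_vector_derivative (A *v e t + gain K s (outp c s (e t)) + d t)) (at t within {t..})"
      and "t \<ge> 0" for e d t
  proof -
    define \<phi> where "\<phi> t = exp (2 * l * t) * w (e t)" for t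
    have "\<phi> t \<le> \<phi> 0"
    proof (rule right_derivative_nonpos_imp_le[OF \<open>t \<ge> 0\<close>])
      show "continuous_on {0..t} \<phi>"
        unfolding \<phi>_def w_def
        by (intro continuous_intros continuous_on_subset[OF cont]) auto
      fix u :: real assume "0 \<le> u"
      let ?e' = "A *v e u + gain K s (outp c s (e u)) + d u"
      have he: "((\<lambda>t. h j \<bullet> e t) has_real_derivative (h j \<bullet> ?e')) (at u within {u..})" for j
        using bounded_linear.has_vector_derivative[OF bounded_linear_inner_right deriv[OF \<open>0 \<le> u\<close>], of "h j"]
        by (simp add: has_real_derivative_iff_has_vector_derivative)
      have "(\<phi> has_real_derivative
          (exp (2 * l * u) * (2 * l)) * w (e u) + (\<Sum>j\<in>J. 2 * (h j \<bullet> e u) * (h j \<bullet> ?e')) * exp (2 * l * u)) (at u within {u..})"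
        unfolding \<phi>_def w_def
        by (intro DERIV_mult DERIV_sum) (auto intro!: derivative_eq_intros he)
      moreover have "(exp (2 * l * u) * (2 * l)) * w (e u) + (\<Sum>j\<in>J. 2 * (h j \<bullet> e u) * (h j \<bullet> ?e')) * exp (2 * l * u) \<le> 0"
      proof -
        \<comment> \<open>Every \<open>h j\<close> annihilates \<open>V\<close>, so the disturbance
          drops out of the derivative.\<close>
        have "h j \<bullet> ?e' = h j \<bullet> (A *v e u + gain K s (outp c s (e u)))" if "j \<in> J" for j
          using d[OF \<open>0 \<le> u\<close>] that by (simp add: V inner_add_right)
        then have "(\<Sum>j\<in>J. 2 * (h j \<bullet> e u) * (h j \<bullet> ?e'))
            = 2 * (\<Sum>j\<in>J. (h j \<bullet> (A *v e u + gain K s (outp c s (e u)))) * (h j \<bullet> e u))"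
          by (simp add: sum_distrib_left algebra_simps)
        also have "\<dots> \<le> - 2 * l * w (e u)" using K[of "e u"] by (simp add: w_def)
        finally have "2 * l * w (e u) + (\<Sum>j\<in>J. 2 * (h j \<bullet> e u) * (h j \<bullet> ?e')) \<le> 0" by simp
        then have "exp (2 * l * u) * (2 * l * w (e u) + (\<Sum>j\<in>J. 2 * (h j \<bullet> e u) * (h j \<bullet> ?e'))) \<le> 0"
          by (simp add: mult_le_0_iff)
        then show ?thesis by (simp add: algebra_simps)
      qed
      ultimately show "\<exists>D\<le>0. (\<phi> has_real_derivative D) (at u within {u..})" by blast
    qed
    then have "w (e t) \<le> (exp (- l * t))\<^sup>2 * w (e 0)"
      by (simp add: \<phi>_def exp_minus field_simps flip: exp_of_nat_mult)
    then have "sqrt (w (e t)) \<le> exp (- l * t) * sqrt (w (e 0))"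
      by (metis real_sqrt_le_mono real_sqrt_mult real_sqrt_abs abs_exp_cancel)
    also have "\<dots> \<le> exp (- lam * t) * (H * norm (e 0))"
      using H[of "e 0"] \<open>lam \<le> l\<close> \<open>t \<ge> 0\<close>
      by (intro mult_mono) (auto simp: mult_right_mono w_def sum_nonneg)
    finally have "b * sqrt (w (e t)) \<le> b * (exp (- lam * t) * (H * norm (e 0)))"
      using \<open>b \<ge> 0\<close> by (rule mult_left_mono)
    with b[of "e t"] show ?thesis by (simp add: algebra_simps)
  qed
  have "b * H \<ge> 0" using \<open>b \<ge> 0\<close> by (simp add: H_def sum_nonneg)
  then show ?thesis using decay by blast
qed

subsection \<open>Projected averaging\<close>

definition max_norm :: "'i set \<Rightarrow> ('i \<Rightarrow> 'a::real_normed_vector) \<Rightarrow> real" where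
  "max_norm I z = Max ((\<lambda>i. norm (z i)) ` I)"

lemma norm_le_max_norm: "finite I \<Longrightarrow> i \<in> I \<Longrightarrow> norm (z i) \<le> max_norm I z"
  by (simp add: max_norm_def)

lemma max_norm_le_iff: "finite I \<Longrightarrow> I \<noteq> {} \<Longrightarrow> max_norm I z \<le> b \<longleftrightarrow> (\<forall>i\<in>I. norm (z i) \<le> b)"
  by (simp add: max_norm_def)

lemma max_norm_nonneg: "finite I \<Longrightarrow> I \<noteq> {} \<Longrightarrow> 0 \<le> max_norm I z"
  using norm_le_max_norm norm_ge_zero order_trans by (metis ex_in_conv)

lemma max_norm_triangle:
  assumes "finite I" "I \<noteq> {}"
  shows "max_norm I (\<lambda>i. x i + y i) \<le> max_norm I x + max_norm I y"
  using assms by (simp add: max_norm_le_iff) (metis add_mono norm_le_max_norm norm_triangle_le)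

lemma max_norm_scaleR:
  assumes "finite I" "I \<noteq> {}"
  shows "max_norm I (\<lambda>i. a *\<^sub>R x i) = \<bar>a\<bar> * max_norm I x"
proof -
  have "mono (\<lambda>t. \<bar>a\<bar> * t)" by (simp add: mono_def mult_left_mono)
  then show ?thesis
    using mono_Max_commute[of "\<lambda>t. \<bar>a\<bar> * t" "(\<lambda>i. norm (x i)) ` I"] assms
    by (simp add: max_norm_def image_image)
qed

definition proj_avg :: "('i \<Rightarrow> 'a::real_inner set) \<Rightarrow> ('i \<Rightarrow> 'i set) \<Rightarrow> ('i \<Rightarrow> 'a) \<Rightarrow> 'i \<Rightarrow> 'a" where
  "proj_avg V Nb z i = orth_proj (V i) ((1 / real (card (Nb i))) *\<^sub>R (\<Sum>j\<in>Nb i. z j))"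

text \<open>Variance identity: with \<open>v\<close> the mean, the squared deviations sum to the sum
  of \<open>(norm (z j))\<^sup>2\<close> minus \<open>card J\<close> times
  \<open>(norm v)\<^sup>2\<close>, which is at most zero here.\<close>

lemma average_of_unit_ball_norm_ge_1:
  fixes z :: "'i \<Rightarrow> 'a::real_inner"
  assumes "finite J" "J \<noteq> {}" and z: "\<And>j. j \<in> J \<Longrightarrow> norm (z j) \<le> 1"
    and "1 \<le> norm ((1 / real (card J)) *\<^sub>R (\<Sum>j\<in>J. z j))" and "k \<in> J"
  shows "z k = (1 / real (card J)) *\<^sub>R (\<Sum>j\<in>J. z j)"
proof -
  define v where "v = (1 / real (card J)) *\<^sub>R (\<Sum>j\<in>J. z j)"
  have "card J > 0" using assms(1,2) by (simp add: card_gt_0_iff)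
  then have sum_z: "(\<Sum>j\<in>J. z j) = real (card J) *\<^sub>R v" by (simp add: v_def)
  have "(\<Sum>j\<in>J. (norm (z j - v))\<^sup>2) = (\<Sum>j\<in>J. (norm (z j))\<^sup>2) + real (card J) * (v \<bullet> v) - 2 * ((\<Sum>j\<in>J. z j) \<bullet> v)"
    by (simp add: power2_norm_eq_inner inner_diff_left inner_diff_right inner_commute inner_sum_left inner_sum_right
        sum.distrib sum_subtractf sum_distrib_left algebra_simps)
  also have "\<dots> = (\<Sum>j\<in>J. (norm (z j))\<^sup>2) - real (card J) * (norm v)\<^sup>2"
    by (simp add: sum_z power2_norm_eq_inner)
  also have "\<dots> \<le> (\<Sum>j\<in>J. 1) - real (card J) * 1"
    using z assms(4) by (intro diff_mono sum_mono mult_left_mono) (auto simp: v_def power_le_one one_le_power)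
  finally have "(\<Sum>j\<in>J. (norm (z j - v))\<^sup>2) \<le> 0" by simp
  moreover have "(norm (z k - v))\<^sup>2 \<le> (\<Sum>j\<in>J. (norm (z j - v))\<^sup>2)"
    using assms(1,5) by (intro member_le_sum) auto
  ultimately have "(norm (z k - v))\<^sup>2 \<le> 0" by linarith
  then show ?thesis by (simp add: v_def)
qed

section \<open>Contraction of a power of the projected average on one fixed graph\<close>

locale projected_consensus =
  fixes I :: "'i set" and V :: "'i \<Rightarrow> 'a::euclidean_space set" and Nb :: "'i \<Rightarrow> 'i set"
  assumes fin: "finite I" and ne: "I \<noteq> {}"
    and sub: "\<And>i. i \<in> I \<Longrightarrow> subspace (V i)"
    and Nb: "\<And>i. i \<in> I \<Longrightarrow> Nb i \<subseteq> I \<and> Nb i \<noteq> {}"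
begin

abbreviation "S \<equiv> proj_avg V Nb"
abbreviation "M \<equiv> max_norm I"

lemma Nb_finite: "i \<in> I \<Longrightarrow> finite (Nb i) \<and> card (Nb i) > 0"
  using Nb fin by (meson card_gt_0_iff finite_subset)

lemma norm_average_le:
  assumes "i \<in> I"
  shows "norm ((1 / real (card (Nb i))) *\<^sub>R (\<Sum>j\<in>Nb i. z j)) \<le> M z"
proof -
  have "norm (\<Sum>j\<in>Nb i. z j) \<le> (\<Sum>j\<in>Nb i. M z)"
    using Nb[OF assms] fin by (intro sum_norm_le) (auto intro: norm_le_max_norm)
  then show ?thesis using Nb_finite[OF assms] by (simp add: field_simps)
qed

lemma norm_S_le: "i \<in> I \<Longrightarrow> norm (S z i) \<le> M z"
  unfolding proj_avg_def using norm_orth_proj_le[OF sub] norm_average_le order_trans by blast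

lemma max_norm_S_le: "M (S z) \<le> M z"
  using norm_S_le fin ne by (simp add: max_norm_le_iff)

lemma max_norm_S_pow_le: "M ((S ^^ k) z) \<le> M z"
proof (induction k)
  case (Suc k)
  then show ?case using max_norm_S_le[of "(S ^^ k) z"] by simp
qed simp

lemma S_add: "i \<in> I \<Longrightarrow> S (\<lambda>i. x i + y i) i = S x i + S y i"
  using linear_add[OF linear_orth_proj[OF sub]]
  by (simp add: proj_avg_def sum.distrib scaleR_add_right)

lemma S_scaleR: "i \<in> I \<Longrightarrow> S (\<lambda>i. a *\<^sub>R x i) i = a *\<^sub>R S x i"
  using linear_scale[OF linear_orth_proj[OF sub]]
  by (simp add: proj_avg_def scaleR_sum_right[symmetric] scaleR_left_commute)

text \<open>States are total functions on the index type, but \<open>S\<close> is controlled only at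
  indices in \<open>I\<close>. Linearity therefore holds only pointwise on \<open>I\<close>, and the
  laws for powers of \<open>S\<close> go through congruence.\<close>

lemma S_cong: "i \<in> I \<Longrightarrow> (\<And>j. j \<in> I \<Longrightarrow> x j = y j) \<Longrightarrow> S x i = S y i"
  unfolding proj_avg_def using Nb by (metis (no_types, lifting) subsetD sum.cong)

lemma S_pow_cong:
  assumes "i \<in> I" and eq: "\<And>j. j \<in> I \<Longrightarrow> x j = y j"
  shows "(S ^^ k) x i = (S ^^ k) y i"
  using assms(1)
proof (induction k arbitrary: i)
  case 0
  then show ?case using eq by simp
next
  case (Suc k)
  have "S ((S ^^ k) x) i = S ((S ^^ k) y) i" by (rule S_cong[OF Suc.prems Suc.IH])
  then show ?case by simp
qed

lemma S_pow_add: "i \<in> I \<Longrightarrow> (S ^^ k) (\<lambda>i. x i + y i) i = (S ^^ k) x i + (S ^^ k) y i"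
proof (induction k arbitrary: i)
  case (Suc k)
  have "(S ^^ Suc k) (\<lambda>i. x i + y i) i = S (\<lambda>i. (S ^^ k) x i + (S ^^ k) y i) i"
    using Suc by (auto intro: S_cong)
  then show ?case using S_add[OF Suc.prems] by simp
qed simp

lemma S_pow_scaleR: "i \<in> I \<Longrightarrow> (S ^^ k) (\<lambda>i. a *\<^sub>R x i) i = a *\<^sub>R (S ^^ k) x i"
proof (induction k arbitrary: i)
  case (Suc k)
  have "(S ^^ Suc k) (\<lambda>i. a *\<^sub>R x i) i = S (\<lambda>i. a *\<^sub>R (S ^^ k) x i) i"
    using Suc by (auto intro: S_cong)
  then show ?case using S_scaleR[OF Suc.prems] by simp
qed simp

text \<open>Averaging vectors of the unit ball yields a unit vector only if they all coincide, so a unit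
  vector in the image of \<open>S ^^ Suc d\<close> propagates backwards along the arcs.\<close>
lemma unit_vector_propagates:
  assumes "M z \<le> 1"
  shows "i \<in> I \<Longrightarrow> norm ((S ^^ Suc k) z i) \<ge> 1 \<Longrightarrow> (l, i) \<in> {(j, i). j \<in> Nb i \<and> i \<in> I} ^^ d \<Longrightarrow> d \<le> k
    \<Longrightarrow> (S ^^ Suc k) z i \<in> V l"
proof (induction d arbitrary: i k)
  case 0
  then show ?case using orth_proj_mem[OF sub] by (simp add: proj_avg_def)
next
  case (Suc d)
  obtain j where lj: "(l, j) \<in> {(j, i). j \<in> Nb i \<and> i \<in> I} ^^ d" and j: "j \<in> Nb i"
    using Suc.prems(3) by auto
  \<comment> \<open>Each arc walked back uses up one application of \<open>S\<close>;
    \<open>d \<le> k\<close> ensures that enough of them remain.\<close>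
  obtain k' where k: "k = Suc k'" "d \<le> k'" using Suc.prems(4) by (cases k) auto
  define y where "y = (S ^^ k) z"
  define a where "a = (1 / real (card (Nb i))) *\<^sub>R (\<Sum>j\<in>Nb i. y j)"
  have y1: "norm (y j) \<le> 1" if "j \<in> I" for j
    using norm_le_max_norm[OF fin that, of y] max_norm_S_pow_le[of k z] assms by (simp add: y_def)
  have Si: "(S ^^ Suc k) z i = orth_proj (V i) a" by (simp add: y_def a_def proj_avg_def)
  have "norm a \<le> 1" unfolding a_def using norm_average_le[OF Suc.prems(1), of y] max_norm_S_pow_le[of k z] assms
    by (simp add: y_def)
  \<comment> \<open>Neither operation may lose length: the projection does not shorten
    \<open>a\<close>, so \<open>a\<close> lies in \<open>V i\<close>; the mean has norm at least
    one, so all neighbours carry the same vector \<open>a\<close>.\<close>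
  then have "norm a \<le> norm (orth_proj (V i) a)" using Suc.prems(2) unfolding Si by linarith
  then have "a \<in> V i" by (rule norm_orth_proj_eq_imp_mem[OF sub[OF Suc.prems(1)]])
  then have Sa: "(S ^^ Suc k) z i = a"
    unfolding Si by (intro orth_proj_eqI[OF sub[OF Suc.prems(1)]]) auto
  have "y j = a"
    unfolding a_def
  proof (rule average_of_unit_ball_norm_ge_1)
    show "1 \<le> norm ((1 / real (card (Nb i))) *\<^sub>R (\<Sum>j\<in>Nb i. y j))"
      using Suc.prems(2) unfolding Sa a_def .
  qed (use Nb[OF Suc.prems(1)] Nb_finite[OF Suc.prems(1)] y1 j in auto)
  then have *: "(S ^^ Suc k) z i = (S ^^ Suc k') z j" using Sa unfolding y_def k by simp
  show ?case
    unfolding * using Suc.IH[of j k'] lj k Suc.prems(1,2) Nb[OF Suc.prems(1)] j unfolding * by blast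
qed

lemma continuous_on_S_pow: "i \<in> I \<Longrightarrow> continuous_on UNIV (\<lambda>z. (S ^^ k) z i)"
proof (induction k arbitrary: i)
  case (Suc k)
  have "continuous_on UNIV (\<lambda>z. orth_proj (V i) ((1 / real (card (Nb i))) *\<^sub>R (\<Sum>j\<in>Nb i. (S ^^ k) z j)))"
    using Suc Nb
    by (intro continuous_on_compose2[OF linear_continuous_on[OF linear_conv_bounded_linear[THEN iffD1, OF linear_orth_proj[OF sub[OF Suc.prems]]], of UNIV]]
        continuous_intros) auto
  moreover have "(S ^^ Suc k) z i = orth_proj (V i) ((1 / real (card (Nb i))) *\<^sub>R (\<Sum>j\<in>Nb i. (S ^^ k) z j))" for z
    by (simp add: proj_avg_def[where z = "(S ^^ k) z"])
  ultimately show ?case by (simp only:)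
qed simp

text \<open>A state in the unit ball that kept norm one at some agent would put a nonzero vector
  into every \<open>V l\<close>. So the bound is strict at each state; compactness makes it uniform
  on the ball, and homogeneity extends it to all states.\<close>

lemma S_pow_contraction:
  assumes conn: "\<And>l i. l \<in> I \<Longrightarrow> i \<in> I \<Longrightarrow> (l, i) \<in> {(j, i). j \<in> Nb i \<and> i \<in> I}\<^sup>*"
    and triv: "(\<Inter>i\<in>I. V i) = {0}"
  shows "\<exists>N \<rho>. 0 < \<rho> \<and> \<rho> < 1 \<and> (\<forall>z. M ((S ^^ N) z) \<le> \<rho> * M z)"
proof -
  define d where "d l i = (SOME d. (l, i) \<in> {(j, i). j \<in> Nb i \<and> i \<in> I} ^^ d)" for l i
  have d: "(l, i) \<in> {(j, i). j \<in> Nb i \<and> i \<in> I} ^^ d l i" if "l \<in> I" "i \<in> I" for l i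
    unfolding d_def using rtrancl_imp_relpow[OF conn[OF that]] by (rule someI_ex)
  \<comment> \<open>One exponent must serve all pairs of vertices, so the longest of the chosen
    walks decides.\<close>
  define k where "k = Max ((\<lambda>(l, i). d l i) ` (I \<times> I))"
  have dk: "d l i \<le> k" if "l \<in> I" "i \<in> I" for l i
    unfolding k_def using fin that by (intro Max_ge) auto
  have strict: "norm ((S ^^ Suc k) z i) < 1" if "M z \<le> 1" "i \<in> I" for z i
  proof (rule ccontr)
    assume "\<not> norm ((S ^^ Suc k) z i) < 1"
    then have *: "norm ((S ^^ Suc k) z i) \<ge> 1" by simp
    then have "(S ^^ Suc k) z i \<in> V l" if "l \<in> I" for l
      using unit_vector_propagates[OF \<open>M z \<le> 1\<close> \<open>i \<in> I\<close> _ d dk] that \<open>i \<in> I\<close> by blast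
    then have "(S ^^ Suc k) z i \<in> (\<Inter>i\<in>I. V i)" by blast
    then show False using * unfolding triv by simp
  qed
  \<comment> \<open>Coordinates outside \<open>I\<close> are pinned to zero, which makes
    \<open>B\<close> compact in the product topology even for an infinite index type.\<close>
  define B where "B = (\<Pi>\<^sub>E i\<in>UNIV. if i \<in> I then cball (0::'a) 1 else {0})"
  have "compactin (product_topology (\<lambda>_. euclidean) UNIV) B"
    unfolding B_def compactin_PiE by (auto simp: compactin_euclidean_iff)
  then have "compact B" by (simp add: euclidean_product_topology compactin_euclidean_iff)
  have B: "z \<in> B" if "M z \<le> 1" "\<And>i. i \<notin> I \<Longrightarrow> z i = 0" for z
    using order_trans[OF norm_le_max_norm[OF fin] that(1)] that(2) by (auto simp: B_def)
  have B_le: "M z \<le> 1" if "z \<in> B" for z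
    using that fin ne by (auto simp: B_def PiE_iff max_norm_le_iff split: if_splits)
  have "B \<noteq> {}" by (auto simp: B_def PiE_eq_empty_iff)
  have "\<exists>x\<in>B. \<forall>y\<in>B. (\<Sum>i\<in>{i}. norm ((S ^^ Suc k) y i)) \<le> norm ((S ^^ Suc k) x i)" if "i \<in> I" for i
    using \<open>compact B\<close> \<open>B \<noteq> {}\<close> continuous_attains_sup[of B "\<lambda>z. norm ((S ^^ Suc k) z i)"]
      continuous_on_norm[OF continuous_on_subset[OF continuous_on_S_pow[OF that, of "Suc k"] subset_UNIV]]
    by simp
  then obtain X where X: "\<And>i. i \<in> I \<Longrightarrow> X i \<in> B"
    and Xmax: "\<And>i y. i \<in> I \<Longrightarrow> y \<in> B \<Longrightarrow> norm ((S ^^ Suc k) y i) \<le> norm ((S ^^ Suc k) (X i) i)"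
    by simp metis
  define \<rho>' where "\<rho>' = Max ((\<lambda>i. norm ((S ^^ Suc k) (X i) i)) ` I)"
  have "\<rho>' < 1" unfolding \<rho>'_def using fin ne strict X B_le by (subst Max_less_iff) auto
  \<comment> \<open>The value \<open>1 / 2\<close> keeps the factor positive; a root of it is
    divided by later.\<close>
  define \<rho> where "\<rho> = max \<rho>' (1 / 2)"
  have "0 < \<rho>" "\<rho> < 1" using \<open>\<rho>' < 1\<close> by (auto simp: \<rho>_def)
  have bound: "norm ((S ^^ Suc k) y i) \<le> \<rho>" if "y \<in> B" "i \<in> I" for y i
  proof -
    have "norm ((S ^^ Suc k) (X i) i) \<le> \<rho>'" unfolding \<rho>'_def using fin that by (intro Max_ge) auto
    then show ?thesis using Xmax[OF that(2,1)] by (simp add: \<rho>_def)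
  qed
  have "M ((S ^^ Suc k) z) \<le> \<rho> * M z" for z
  proof (cases "M z = 0")
    case True
    then show ?thesis using max_norm_S_pow_le[of "Suc k" z] \<open>0 < \<rho>\<close> by simp
  next
    case False
    then have "M z > 0" using max_norm_nonneg[OF fin ne, of z] by simp
    define y where "y i = (if i \<in> I then (1 / M z) *\<^sub>R z i else 0)" for i
    have "M y \<le> 1"
      using \<open>M z > 0\<close> norm_le_max_norm[OF fin, of _ z] by (simp add: max_norm_le_iff fin ne y_def)
    then have "y \<in> B" by (rule B) (simp add: y_def)
    have "norm ((S ^^ Suc k) z i) \<le> \<rho> * M z" if "i \<in> I" for i
    proof -
      have "(S ^^ Suc k) z i = (S ^^ Suc k) (\<lambda>i. M z *\<^sub>R y i) i"
        by (rule S_pow_cong[OF that]) (use \<open>M z > 0\<close> in \<open>simp add: y_def\<close>)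
      then have "norm ((S ^^ Suc k) z i) = M z * norm ((S ^^ Suc k) y i)"
        using S_pow_scaleR[OF that] \<open>M z > 0\<close> by (simp del: funpow.simps)
      then show ?thesis using bound[OF \<open>y \<in> B\<close> that] \<open>M z > 0\<close> by (simp add: mult.commute mult_left_mono)
    qed
    then show ?thesis by (simp add: max_norm_le_iff fin ne)
  qed
  then show ?thesis using \<open>0 < \<rho>\<close> \<open>\<rho> < 1\<close> by blast
qed

end

section \<open>Norms adapted to a graph, and decay in them\<close>

text \<open>The norm \<open>q\<close> belongs to one graph, whereas \<open>max_norm I\<close> is
  common to all of them; \<open>\<kappa>\<close> is the price of passing between the two at a
  switch.\<close>

locale contracting_consensus = projected_consensus I V Nb
  for I :: "'i set" and V :: "'i \<Rightarrow> 'a::euclidean_space set" and Nb +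
  fixes q :: "('i \<Rightarrow> 'a) \<Rightarrow> real" and r \<kappa> :: real
  assumes q_add: "q (\<lambda>i. x i + y i) \<le> q x + q y"
    and q_scaleR: "q (\<lambda>i. a *\<^sub>R x i) = \<bar>a\<bar> * q x"
    and q_lower: "max_norm I x \<le> q x" and q_upper: "q x \<le> \<kappa> * max_norm I x"
    and q_S: "q (proj_avg V Nb x) \<le> r * q x"
    and r: "0 < r" "r < 1" and \<kappa>: "1 \<le> \<kappa>"

context projected_consensus
begin

text \<open>If \<open>S ^^ N\<close> contracts by the factor \<open>r ^ N\<close>, then \<open>S\<close> itself contracts by the factor \<open>r\<close> in the
  equivalent norm \<open>\<Sum>k<N. r powi (- k) * M (S\<^sup>k z)\<close>.\<close>
lemma contracting_norm_exists:
  assumes conn: "\<And>l i. l \<in> I \<Longrightarrow> i \<in> I \<Longrightarrow> (l, i) \<in> {(j, i). j \<in> Nb i \<and> i \<in> I}\<^sup>*"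
    and triv: "(\<Inter>i\<in>I. V i) = {0}"
  shows "\<exists>q r \<kappa>. contracting_consensus I V Nb q r \<kappa>"
proof -
  obtain N \<rho> where \<rho>: "0 < \<rho>" "\<rho> < 1" and contr: "\<And>z. M ((S ^^ N) z) \<le> \<rho> * M z"
    using S_pow_contraction[OF conn triv] by blast
  \<comment> \<open>The term for \<open>k = 0\<close> must be present in \<open>q\<close>, since it
    yields the lower bound by \<open>M\<close>. The zeroth power is the identity, which does not
    contract a constant unit state.\<close>
  have "N > 0"
  proof (rule ccontr)
    assume "\<not> N > 0"
    obtain b :: 'a where "norm b = 1" using vector_choose_size[of 1] by auto
    then have "M (\<lambda>_. b) = 1" using ne by (simp add: max_norm_def image_constant_conv)
    with contr[of "\<lambda>_. b"] \<open>\<not> N > 0\<close> \<rho> show False by simp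
  qed
  define r where "r = root N \<rho>"
  have r: "0 < r" "r < 1" "r ^ N = \<rho>" using \<open>N > 0\<close> \<rho> by (auto simp: r_def)
  define q where "q z = (\<Sum>k<N. M ((S ^^ k) z) / r ^ k)" for z
  define \<kappa> where "\<kappa> = (\<Sum>k<N. 1 / r ^ k)"
  have M_cong: "M x = M y" if "\<And>i. i \<in> I \<Longrightarrow> x i = y i" for x y :: "'i \<Rightarrow> 'a"
    using that by (simp add: max_norm_def cong: image_cong_simp)
  have "contracting_consensus I V Nb q r \<kappa>"
  proof unfold_locales
    fix x y :: "'i \<Rightarrow> 'a" and a :: real
    have "M ((S ^^ k) (\<lambda>i. x i + y i)) \<le> M ((S ^^ k) x) + M ((S ^^ k) y)" for k
      using max_norm_triangle[OF fin ne, of "(S ^^ k) x" "(S ^^ k) y"]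
      by (simp only: M_cong[OF S_pow_add[where k = k]])
    then show "q (\<lambda>i. x i + y i) \<le> q x + q y"
      unfolding q_def sum.distrib[symmetric] add_divide_distrib[symmetric] using r
      by (intro sum_mono divide_right_mono) auto
    have "M ((S ^^ k) (\<lambda>i. a *\<^sub>R x i)) = \<bar>a\<bar> * M ((S ^^ k) x)" for k
      using max_norm_scaleR[OF fin ne, of a "(S ^^ k) x"]
      by (simp only: M_cong[OF S_pow_scaleR[where k = k]])
    then show "q (\<lambda>i. a *\<^sub>R x i) = \<bar>a\<bar> * q x"
      by (simp add: q_def sum_distrib_left)
    have "M ((S ^^ 0) x) / r ^ 0 \<le> q x"
      unfolding q_def using \<open>N > 0\<close> r
      by (intro member_le_sum divide_nonneg_nonneg max_norm_nonneg fin ne) auto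
    then show "M x \<le> q x" by simp
    show "q x \<le> \<kappa> * M x"
      unfolding q_def \<kappa>_def sum_distrib_right using r max_norm_S_pow_le
      by (intro sum_mono) (simp add: divide_right_mono)
    have "q (S x) = (\<Sum>k<N. r * (M ((S ^^ Suc k) x) / r ^ Suc k))"
      unfolding q_def using r by (simp add: funpow_swap1)
    also have "\<dots> = r * (\<Sum>k<N. M ((S ^^ Suc k) x) / r ^ Suc k)" by (simp add: sum_distrib_left)
    also have "(\<Sum>k<N. M ((S ^^ Suc k) x) / r ^ Suc k) = (\<Sum>k<Suc N. M ((S ^^ k) x) / r ^ k) - M x"
      by (subst sum.lessThan_Suc_shift) simp
    also have "\<dots> = q x + M ((S ^^ N) x) / \<rho> - M x" by (simp add: q_def r(3))
    \<comment> \<open>As \<open>r ^ N = \<rho>\<close>, the new last term of the shifted sum is at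
      most the dropped first term \<open>M x\<close>.\<close>
    also have "r * \<dots> \<le> r * q x"
      using contr[of x] \<rho> r by (intro mult_left_mono) (auto simp: field_simps)
    finally show "q (S x) \<le> r * q x" .
    have "1 / r ^ 0 \<le> \<kappa>" unfolding \<kappa>_def using \<open>N > 0\<close> r by (intro member_le_sum) auto
    then show "1 \<le> \<kappa>" by simp
  qed (use r in auto)
  then show ?thesis by blast
qed

text \<open>Weakening \<open>r\<close> and \<open>\<kappa>\<close> allows one pair of constants for
  all graphs of a finite family.\<close>

lemma contracting_consensus_mono:
  assumes "contracting_consensus I V Nb q r \<kappa>" "r \<le> r'" "r' < 1" "\<kappa> \<le> \<kappa>'"
  shows "contracting_consensus I V Nb q r' \<kappa>'"
proof -
  interpret c: contracting_consensus I V Nb q r \<kappa> by fact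
  show ?thesis
  proof unfold_locales
    fix x :: "'i \<Rightarrow> 'a"
    have nonneg: "0 \<le> M x" by (rule max_norm_nonneg[OF fin ne])
    then have "0 \<le> q x" using c.q_lower[of x] by linarith
    then show "q (proj_avg V Nb x) \<le> r' * q x"
      using c.q_S[of x] mult_right_mono[OF \<open>r \<le> r'\<close>] by force
    show "q x \<le> \<kappa>' * M x"
      using c.q_upper[of x] mult_right_mono[OF \<open>\<kappa> \<le> \<kappa>'\<close> nonneg] by linarith
  qed (use assms c.q_add c.q_scaleR c.q_lower c.r c.\<kappa> in auto)
qed

text \<open>Apply the projection to the error equation. It is idempotent, and splitting each
  neighbour's error into \<open>z j\<close> and the rest leaves \<open>S\<close> acting on the
  \<open>z\<close> components, while the rest enters the forcing with factor
  \<open>g\<close>.\<close>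

lemma projected_error_derivative:
  assumes "i \<in> I"
    and "(e i has_vector_derivative (l - g *\<^sub>R orth_proj (V i)
      (e i t - (1 / real (card (Nb i))) *\<^sub>R (\<Sum>j\<in>Nb i. e j t)))) (at t within {t..})"
  defines "z \<equiv> \<lambda>j t. orth_proj (V j) (e j t)"
  shows "(z i has_vector_derivative ((orth_proj (V i) l + g *\<^sub>R S (\<lambda>j. e j t - z j t) i)
      - g *\<^sub>R (z i t - S (\<lambda>j. z j t) i))) (at t within {t..})"
proof -
  note lin = linear_orth_proj[OF sub[OF \<open>i \<in> I\<close>]]
  have idem: "orth_proj (V i) (orth_proj (V i) x) = orth_proj (V i) x" for x
    by (rule orth_proj_eqI[OF sub[OF \<open>i \<in> I\<close>]]) (simp_all add: orth_proj_mem sub \<open>i \<in> I\<close>)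
  have "S (\<lambda>j. e j t) i = S (\<lambda>j. z j t) i + S (\<lambda>j. e j t - z j t) i"
    using S_add[OF \<open>i \<in> I\<close>, of "\<lambda>j. z j t" "\<lambda>j. e j t - z j t"] by simp
  moreover define a where "a = (1 / real (card (Nb i))) *\<^sub>R (\<Sum>j\<in>Nb i. e j t)"
  ultimately have "orth_proj (V i) a = S (\<lambda>j. z j t) i + S (\<lambda>j. e j t - z j t) i"
    by (simp add: proj_avg_def)
  moreover have "orth_proj (V i) (l - g *\<^sub>R orth_proj (V i) (e i t - a))
      = orth_proj (V i) l - g *\<^sub>R (z i t - orth_proj (V i) a)"
    by (simp add: linear_diff[OF lin] linear_scale[OF lin] idem z_def)
  ultimately have "orth_proj (V i) (l - g *\<^sub>R orth_proj (V i) (e i t - a))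
      = (orth_proj (V i) l + g *\<^sub>R S (\<lambda>j. e j t - z j t) i) - g *\<^sub>R (z i t - S (\<lambda>j. z j t) i)"
    by (simp add: algebra_simps)
  then show ?thesis
    using bounded_linear.has_vector_derivative[OF lin[unfolded linear_conv_bounded_linear] assms(2)]
    by (simp add: z_def a_def)
qed

end

context contracting_consensus
begin

lemma q_nonneg: "0 \<le> q x"
  using q_lower[of x] max_norm_nonneg[OF fin ne] order_trans by blast

text \<open>Lipschitz estimate in the maximum norm; continuity and one-sided differential bounds for
  \<open>q\<close> follow from it without a formula for \<open>q\<close>.\<close>

lemma q_le_add: "q x \<le> q y + \<kappa> * M (\<lambda>i. x i - y i)"
  using q_add[of y "\<lambda>i. x i - y i"] q_upper[of "\<lambda>i. x i - y i"] by simp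

lemma continuous_on_q:
  assumes "\<And>i. i \<in> I \<Longrightarrow> continuous_on T (z i)"
  shows "continuous_on T (\<lambda>t. q (\<lambda>i. z i t))"
  unfolding continuous_on_def
proof
  fix t assume "t \<in> T"
  have "((\<lambda>s. \<kappa> * (\<Sum>i\<in>I. norm (z i s - z i t))) \<longlongrightarrow> \<kappa> * (\<Sum>i\<in>I. norm (z i t - z i t))) (at t within T)"
    using assms \<open>t \<in> T\<close> unfolding continuous_on_def by (intro tendsto_intros) auto
  then have lim: "((\<lambda>s. \<kappa> * (\<Sum>i\<in>I. norm (z i s - z i t))) \<longlongrightarrow> 0) (at t within T)" by simp
  have M_le: "M x \<le> (\<Sum>i\<in>I. norm (x i))" for x :: "'i \<Rightarrow> 'a"
    using fin ne member_le_sum[of _ I "\<lambda>i. norm (x i)"] by (simp add: max_norm_le_iff)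
  have "\<bar>q (\<lambda>i. z i s) - q (\<lambda>i. z i t)\<bar> \<le> \<kappa> * (\<Sum>i\<in>I. norm (z i s - z i t))" for s
  proof -
    have "\<kappa> * M (\<lambda>i. z i s - z i t) \<le> \<kappa> * (\<Sum>i\<in>I. norm (z i s - z i t))"
      and "\<kappa> * M (\<lambda>i. z i t - z i s) \<le> \<kappa> * (\<Sum>i\<in>I. norm (z i s - z i t))"
      using M_le[of "\<lambda>i. z i s - z i t"] M_le[of "\<lambda>i. z i t - z i s"] \<kappa>
      by (auto simp: norm_minus_commute intro!: mult_left_mono)
    then show ?thesis
      using q_le_add[of "\<lambda>i. z i s" "\<lambda>i. z i t"] q_le_add[of "\<lambda>i. z i t" "\<lambda>i. z i s"] by linarith
  qed
  then have "((\<lambda>s. q (\<lambda>i. z i s) - q (\<lambda>i. z i t)) \<longlongrightarrow> 0) (at t within T)"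
    by (intro Lim_null_comparison[OF _ lim] always_eventually) auto
  then show "((\<lambda>s. q (\<lambda>i. z i s)) \<longlongrightarrow> q (\<lambda>i. z i t)) (at t within T)"
    by (simp add: LIM_zero_iff)
qed

text \<open>Substitute for a chain rule: inside \<open>q\<close>, the trajectory may be replaced by
  its tangent up to an error of small slope.\<close>

lemma q_right_derivative_bound:
  assumes "\<And>i. i \<in> I \<Longrightarrow> (z i has_vector_derivative v i) (at t within {t..})" and "\<epsilon> > 0"
  shows "\<forall>\<^sub>F s in at_right t. q (\<lambda>i. z i s) \<le> q (\<lambda>i. z i t + (s - t) *\<^sub>R v i) + \<epsilon> * (s - t)"
proof -
  have "\<forall>\<^sub>F s in at_right t. \<forall>i\<in>I. norm (z i s - (z i t + (s - t) *\<^sub>R v i)) \<le> \<epsilon> / \<kappa> * (s - t)"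
    using fin assms \<kappa> by (intro eventually_ball_finite ballI has_vector_derivative_right_eventually) auto
  then show ?thesis
  proof eventually_elim
    case (elim s)
    then have "M (\<lambda>i. z i s - (z i t + (s - t) *\<^sub>R v i)) \<le> \<epsilon> / \<kappa> * (s - t)"
      by (simp add: max_norm_le_iff fin ne)
    then have "\<kappa> * M (\<lambda>i. z i s - (z i t + (s - t) *\<^sub>R v i)) \<le> \<kappa> * (\<epsilon> / \<kappa> * (s - t))"
      using \<kappa> by (intro mult_left_mono) auto
    also have "\<dots> = \<epsilon> * (s - t)" using \<kappa> by simp
    finally show ?case using q_le_add[of "\<lambda>i. z i s" "\<lambda>i. z i t + (s - t) *\<^sub>R v i"] by simp
  qed
qed

text \<open>A short Euler step is a convex combination of \<open>z\<close> and \<open>S z\<close>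
  plus forcing, so \<open>q\<close> loses the rate \<open>g * (1 - r)\<close>, and the part of the
  forcing proportional to \<open>z\<close> costs at most \<open>\<kappa> * b\<close>. What remains
  decays at rate \<open>lam + nu\<close> against a forcing of rate \<open>lam\<close>.\<close>

lemma consensus_decay:
  fixes z d :: "'i \<Rightarrow> real \<Rightarrow> 'a"
  assumes "t0 \<le> t1" and cont: "\<And>i. i \<in> I \<Longrightarrow> continuous_on {t0..t1} (z i)"
    and deriv: "\<And>i t. i \<in> I \<Longrightarrow> t0 \<le> t \<Longrightarrow> t < t1 \<Longrightarrow>
      (z i has_vector_derivative (d i t - g *\<^sub>R (z i t - S (\<lambda>j. z j t) i))) (at t within {t..})"
    and d: "\<And>t i. i \<in> I \<Longrightarrow> t0 \<le> t \<Longrightarrow> t < t1 \<Longrightarrow> norm (d i t) \<le> b * M (\<lambda>i. z i t) + F * exp (- lam * t)"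
    and "g > 0" "b \<ge> 0" "F \<ge> 0"
    and rate: "lam + nu \<le> g * (1 - r) - \<kappa> * b" and "nu > 0"
  shows "exp (lam * t1) * q (\<lambda>i. z i t1) \<le> exp (- nu * (t1 - t0)) * (exp (lam * t0) * q (\<lambda>i. z i t0)) + \<kappa> * F / nu"
proof -
  define Q where "Q t = q (\<lambda>i. z i t)" for t
  define \<mu> where "\<mu> = lam + nu"
  \<comment> \<open>After multiplication by \<open>exp (\<mu> * t)\<close> the forcing is
    \<open>\<kappa> * F * exp (nu * t)\<close>; its antiderivative is subtracted.\<close>
  define \<phi> where "\<phi> t = exp (\<mu> * t) * Q t - \<kappa> * F / nu * exp (nu * t)" for t
  have contQ: "continuous_on {t0..t1} Q" unfolding Q_def by (intro continuous_on_q cont)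
  have "\<phi> t1 \<le> \<phi> t0"
  proof (rule right_dini_nonincreasing[OF \<open>t0 \<le> t1\<close>])
    show "continuous_on {t0..t1} \<phi>" unfolding \<phi>_def by (intro continuous_intros contQ)
    fix t \<epsilon> :: real assume t: "t0 \<le> t" "t < t1" and "\<epsilon> > 0"
    \<comment> \<open>Scaled so that this slack contributes slope \<open>\<epsilon> / 2\<close> at
      time \<open>t\<close>, strictly less than the permitted \<open>\<epsilon>\<close>.\<close>
    define \<eta> where "\<eta> = \<epsilon> * exp (- \<mu> * t) / 2"
    have "\<eta> > 0" using \<open>\<epsilon> > 0\<close> by (simp add: \<eta>_def)
    define f where "f = \<kappa> * F * exp (- lam * t)"
    let ?v = "\<lambda>i. d i t - g *\<^sub>R (z i t - S (\<lambda>j. z j t) i)"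
    \<comment> \<open>A smooth function that touches \<open>\<phi>\<close> at \<open>t\<close> and
      lies above it just to the right, so only \<open>P\<close> has to be differentiated.\<close>
    define P where "P s = exp (\<mu> * s) * (Q t + (s - t) * (f - \<mu> * Q t + \<eta>)) - \<kappa> * F / nu * exp (nu * s)" for s
    have "(P has_real_derivative
        exp (\<mu> * t) * \<mu> * (Q t + (t - t) * (f - \<mu> * Q t + \<eta>)) + (f - \<mu> * Q t + \<eta>) * exp (\<mu> * t)
          - \<kappa> * F / nu * (exp (nu * t) * nu)) (at t within {t..})"
      unfolding P_def by (auto intro!: derivative_eq_intros)
    moreover have "exp (\<mu> * t) * \<mu> * (Q t + (t - t) * (f - \<mu> * Q t + \<eta>)) + (f - \<mu> * Q t + \<eta>) * exp (\<mu> * t)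
          - \<kappa> * F / nu * (exp (nu * t) * nu) = \<eta> * exp (\<mu> * t)"
    proof -
      have "f * exp (\<mu> * t) = \<kappa> * F * exp (nu * t)"
        by (simp add: f_def \<mu>_def algebra_simps flip: exp_add)
      then show ?thesis using \<open>nu > 0\<close> by (simp add: algebra_simps)
    qed
    moreover have "\<eta> * exp (\<mu> * t) = \<epsilon> / 2" by (simp add: \<eta>_def flip: exp_add)
    ultimately have "(P has_real_derivative \<epsilon> / 2) (at t within {t..})" by (simp only:)
    then have "\<forall>\<^sub>F s in at_right t. P s \<le> P t + \<epsilon> * (s - t)"
      by (rule has_right_derivative_imp_le) (use \<open>\<epsilon> > 0\<close> in simp)
    moreover have "\<forall>\<^sub>F s in at_right t. Q s \<le> q (\<lambda>i. z i t + (s - t) *\<^sub>R ?v i) + \<eta> * (s - t)"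
      unfolding Q_def by (rule q_right_derivative_bound[OF deriv[OF _ t] \<open>\<eta> > 0\<close>])
    \<comment> \<open>Steps shorter than \<open>1 / g\<close> keep the weight
      \<open>1 - g * h\<close> nonnegative.\<close>
    moreover have "\<forall>\<^sub>F s in at_right t. t < s \<and> s < t + 1 / g"
      unfolding eventually_at_right_field using \<open>g > 0\<close> by (intro exI[of _ "t + 1 / g"]) auto
    ultimately show "\<forall>\<^sub>F s in at_right t. \<phi> s \<le> \<phi> t + \<epsilon> * (s - t)"
    proof eventually_elim
      case (elim s)
      define h where "h = s - t"
      have h: "h > 0" "g * h \<le> 1" using elim(3) \<open>g > 0\<close> by (auto simp: h_def field_simps)
      have "q (\<lambda>i. z i t + h *\<^sub>R ?v i)
          = q (\<lambda>i. ((1 - g * h) *\<^sub>R z i t + (g * h) *\<^sub>R S (\<lambda>j. z j t) i) + h *\<^sub>R d i t)"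
        by (simp add: algebra_simps)
      also have "\<dots> \<le> (q (\<lambda>i. (1 - g * h) *\<^sub>R z i t) + q (\<lambda>i. (g * h) *\<^sub>R S (\<lambda>j. z j t) i)) + q (\<lambda>i. h *\<^sub>R d i t)"
        by (rule order_trans[OF q_add add_right_mono[OF q_add]])
      also have "\<dots> = (1 - g * h) * Q t + g * h * q (S (\<lambda>j. z j t)) + h * q (\<lambda>i. d i t)"
        using h \<open>g > 0\<close> by (simp add: q_scaleR Q_def abs_mult)
      also have "\<dots> \<le> (1 - g * h) * Q t + g * h * (r * Q t) + h * (\<kappa> * b * Q t + f)"
      proof (intro add_mono mult_left_mono order_refl)
        show "q (S (\<lambda>j. z j t)) \<le> r * Q t" unfolding Q_def by (rule q_S)
        have "M (\<lambda>i. d i t) \<le> b * Q t + F * exp (- lam * t)"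
          using d[OF _ t] mult_left_mono[OF q_lower \<open>b \<ge> 0\<close>, of "\<lambda>i. z i t"]
          by (force simp: max_norm_le_iff fin ne Q_def)
        then have "\<kappa> * M (\<lambda>i. d i t) \<le> \<kappa> * (b * Q t + F * exp (- lam * t))"
          using \<kappa> by (intro mult_left_mono) auto
        then show "q (\<lambda>i. d i t) \<le> \<kappa> * b * Q t + f"
          using q_upper[of "\<lambda>i. d i t"] by (simp add: f_def algebra_simps)
      qed (use h \<open>g > 0\<close> in auto)
      also have "\<dots> = Q t + h * (f - (g * (1 - r) - \<kappa> * b) * Q t)" by (simp add: algebra_simps)
      also have "\<dots> \<le> Q t + h * (f - \<mu> * Q t)"
        using h rate q_nonneg[of "\<lambda>i. z i t"]
        by (intro add_left_mono mult_left_mono diff_left_mono mult_right_mono) (auto simp: \<mu>_def Q_def)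
      finally have "Q s \<le> Q t + (s - t) * (f - \<mu> * Q t + \<eta>)"
        using elim(2) by (simp add: h_def algebra_simps)
      then have "exp (\<mu> * s) * Q s \<le> exp (\<mu> * s) * (Q t + (s - t) * (f - \<mu> * Q t + \<eta>))"
        by (intro mult_left_mono) auto
      then have "\<phi> s \<le> P s" by (simp add: \<phi>_def P_def)
      also have "P s \<le> P t + \<epsilon> * (s - t)" by (rule elim(1))
      also have "P t = \<phi> t" by (simp add: P_def \<phi>_def)
      finally show ?case .
    qed
  qed
  then have "exp (\<mu> * t1) * Q t1 \<le> exp (\<mu> * t0) * Q t0 + \<kappa> * F / nu * exp (nu * t1)"
  proof -
    have "0 \<le> \<kappa> * F / nu * exp (nu * t0)" using \<kappa> \<open>F \<ge> 0\<close> \<open>nu > 0\<close> by simp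
    with \<open>\<phi> t1 \<le> \<phi> t0\<close> show ?thesis unfolding \<phi>_def by linarith
  qed
  then have "exp (- nu * t1) * (exp (\<mu> * t1) * Q t1)
      \<le> exp (- nu * t1) * (exp (\<mu> * t0) * Q t0 + \<kappa> * F / nu * exp (nu * t1))"
    by (rule mult_left_mono) simp
  moreover have "exp (- nu * t1) * (exp (\<mu> * t1) * Q t1) = exp (lam * t1) * Q t1"
    by (simp add: \<mu>_def algebra_simps flip: exp_add mult.assoc)
  moreover have "exp (- nu * t1) * (exp (\<mu> * t0) * Q t0) = exp (- nu * (t1 - t0)) * (exp (lam * t0) * Q t0)"
    by (simp add: \<mu>_def algebra_simps flip: exp_add mult.assoc)
  moreover have "exp (- nu * t1) * (\<kappa> * F / nu * exp (nu * t1)) = \<kappa> * F / nu"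
    by (simp add: exp_minus)
  ultimately show ?thesis unfolding Q_def distrib_left by (simp only:)
qed

end

subsection \<open>Dwell time\<close>

text \<open>The absence of a switch gives constancy to the left of a point, membership in
  \<open>dwell_signals\<close> gives it to the right; a locally constant function on a connected
  interval is constant.\<close>

lemma dwell_signal_const:
  assumes \<sigma>: "\<sigma> \<in> dwell_signals P \<tau>" and "0 \<le> a" "a \<le> u" "u < b"
    and no_switch: "\<And>v. a < v \<Longrightarrow> v < b \<Longrightarrow> \<not> switch_at \<sigma> v"
  shows "\<sigma> u = \<sigma> a"
proof (rule connected_local_const[of "{a..<b}"])
  show "\<forall>t\<in>{a..<b}. \<forall>\<^sub>F s in at t within {a..<b}. \<sigma> t = \<sigma> s"
  proof
    fix t assume t: "t \<in> {a..<b}"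
    have "t \<ge> 0" using t \<open>0 \<le> a\<close> by simp
    then have "\<exists>\<epsilon>>0. \<forall>s\<in>{t..<t + \<epsilon>}. \<sigma> s = \<sigma> t" using \<sigma> unfolding dwell_signals_def by blast
    then obtain \<epsilon> where "\<epsilon> > 0" and right: "\<And>s. s \<in> {t..<t + \<epsilon>} \<Longrightarrow> \<sigma> s = \<sigma> t" by blast
    \<comment> \<open>At \<open>t = a\<close> nothing of the interval lies to the left, so a switch
      at \<open>a\<close> itself is allowed.\<close>
    have "\<exists>\<delta>>0. \<forall>s\<in>{t - \<delta><..t}. a \<le> s \<longrightarrow> \<sigma> s = \<sigma> t"
    proof (cases "t = a")
      case True
      then have "\<forall>s\<in>{t - 1<..t}. a \<le> s \<longrightarrow> s = t" by simp
      then show ?thesis using zero_less_one by blast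
    next
      case False
      then have "\<not> switch_at \<sigma> t" using t by (intro no_switch) auto
      then show ?thesis unfolding switch_at_def by blast
    qed
    then obtain \<delta> where "\<delta> > 0" and left: "\<And>s. s \<in> {t - \<delta><..t} \<Longrightarrow> a \<le> s \<Longrightarrow> \<sigma> s = \<sigma> t" by blast
    show "\<forall>\<^sub>F s in at t within {a..<b}. \<sigma> t = \<sigma> s"
      unfolding eventually_at
    proof (intro exI[of _ "min \<epsilon> \<delta>"] conjI ballI impI)
      fix s assume s: "s \<in> {a..<b}" "s \<noteq> t \<and> dist s t < min \<epsilon> \<delta>"
      show "\<sigma> t = \<sigma> s"
      proof (cases "s \<le> t")
        case True
        then show ?thesis using s by (intro left[symmetric]) (auto simp: dist_real_def)
      next
        case False
        then show ?thesis using s by (intro right[symmetric]) (auto simp: dist_real_def)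
      qed
    qed (use \<open>\<epsilon> > 0\<close> \<open>\<delta> > 0\<close> in auto)
  qed
qed (use \<open>a \<le> u\<close> \<open>u < b\<close> in auto)

lemma last_switch_exists:
  assumes \<sigma>: "\<sigma> \<in> dwell_signals P \<tau>" and "t > 0"
  obtains a where "0 \<le> a" "a < t" "a = 0 \<or> switch_at \<sigma> a" "\<And>u. a < u \<Longrightarrow> u < t \<Longrightarrow> \<not> switch_at \<sigma> u"
proof -
  define D where "D = {u \<in> {0<..<t}. switch_at \<sigma> u}"
  have "D \<subseteq> {u \<in> {0<..t}. switch_at \<sigma> u}" by (auto simp: D_def)
  moreover have "finite {u \<in> {0<..t}. switch_at \<sigma> u}" using \<sigma> by (simp add: dwell_signals_def)
  ultimately have fin: "finite (insert 0 D)" using finite_subset by auto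
  define a where "a = Max (insert 0 D)"
  have "a \<in> insert 0 D" unfolding a_def using fin by (intro Max_in) auto
  then have "a < t" "a = 0 \<or> switch_at \<sigma> a" using \<open>t > 0\<close> by (auto simp: D_def)
  have le: "u \<le> a" if "u \<in> insert 0 D" for u unfolding a_def using fin that by (rule Max_ge)
  have "0 \<le> a" by (rule le) simp
  moreover have "\<not> switch_at \<sigma> u" if "a < u" "u < t" for u
    using le[of u] that \<open>0 \<le> a\<close> by (auto simp: D_def)
  ultimately show thesis using that \<open>a < t\<close> \<open>a = 0 \<or> switch_at \<sigma> a\<close> by blast
qed

text \<open>Between consecutive switching times the dwell time absorbs the constant \<open>\<kappa>\<close> incurred by changing
  from one norm to the next, so \<open>L\<close> bounds \<open>W\<close> at every switching time.\<close>
lemma dwell_time_bound: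
  assumes \<sigma>: "\<sigma> \<in> dwell_signals P \<tau>"
    and step: "\<And>a b p. 0 \<le> a \<Longrightarrow> a \<le> b \<Longrightarrow> p \<in> P \<Longrightarrow> (\<And>u. a \<le> u \<Longrightarrow> u < b \<Longrightarrow> \<sigma> u = p) \<Longrightarrow>
      W b \<le> \<kappa> * exp (- nu * (b - a)) * W a + H"
    and W: "\<And>t. 0 \<le> W t" "W 0 \<le> L" and "2 * H \<le> L"
    and \<kappa>: "0 \<le> \<kappa>" "\<kappa> * exp (- nu * \<tau>) \<le> 1 / 2" and "0 \<le> nu" "0 \<le> t"
  shows "W t \<le> \<kappa> * L + H"
proof -
  have "0 \<le> L" using W(1)[of 0] W(2) by linarith
  have piece: "W b \<le> \<kappa> * exp (- nu * (b - a)) * W a + H"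
    if "0 \<le> a" "a < b" "\<And>u. a < u \<Longrightarrow> u < b \<Longrightarrow> \<not> switch_at \<sigma> u" for a b
  proof (rule step)
    show "\<sigma> a \<in> P" using \<sigma> that(1) by (simp add: dwell_signals_def)
    show "\<sigma> u = \<sigma> a" if "a \<le> u" "u < b" for u
      using dwell_signal_const[OF \<sigma> \<open>0 \<le> a\<close> that] \<open>\<And>u. a < u \<Longrightarrow> u < b \<Longrightarrow> \<not> switch_at \<sigma> u\<close> by blast
  qed (use that in auto)
  have at_switch: "W t \<le> L" if "switch_at \<sigma> t" "t > 0" for t
    using that
  proof (induction "card {u \<in> {0<..<t}. switch_at \<sigma> u}" arbitrary: t rule: less_induct)
    case less
    obtain a where a: "0 \<le> a" "a < t" "a = 0 \<or> switch_at \<sigma> a"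
      and between: "\<And>u. a < u \<Longrightarrow> u < t \<Longrightarrow> \<not> switch_at \<sigma> u"
      using last_switch_exists[OF \<sigma> less.prems(2)] by blast
    have "W a \<le> L"
    proof (cases "a = 0")
      case False
      then have sw: "switch_at \<sigma> a" "a > 0" using a by auto
      have "finite {u \<in> {0<..t}. switch_at \<sigma> u}" using \<sigma> by (simp add: dwell_signals_def)
      then have "finite {u \<in> {0<..<t}. switch_at \<sigma> u}" by (rule rev_finite_subset) auto
      then have "card {u \<in> {0<..<a}. switch_at \<sigma> u} < card {u \<in> {0<..<t}. switch_at \<sigma> u}"
        by (rule psubset_card_mono) (use sw a in \<open>auto intro!: psubsetI\<close>)
      then show ?thesis using less.hyps sw by blast
    qed (use W in simp)
    have "\<tau> \<le> t - a"
    proof (cases "a = 0")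
      case True
      then show ?thesis using \<sigma> less.prems by (simp add: dwell_signals_def)
    next
      case False
      then have "0 < a \<and> a < t \<and> switch_at \<sigma> a \<and> switch_at \<sigma> t" using a less.prems by auto
      then show ?thesis using \<sigma> unfolding dwell_signals_def by blast
    qed
    then have "\<kappa> * exp (- nu * (t - a)) \<le> \<kappa> * exp (- nu * \<tau>)"
      using \<kappa> \<open>0 \<le> nu\<close> by (intro mult_left_mono) (auto intro: mult_left_mono)
    \<comment> \<open>A full dwell time has passed, so half of \<open>L\<close> covers the old
      value, and \<open>2 * H \<le> L\<close> leaves the other half for the forcing.\<close>
    then have "\<kappa> * exp (- nu * (t - a)) * W a \<le> 1 / 2 * L"
      using \<kappa> \<open>W a \<le> L\<close> W by (intro mult_mono) auto
    then show ?case using piece[OF a(1,2) between] \<open>2 * H \<le> L\<close> by linarith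
  qed
  show ?thesis
  proof (cases "t = 0")
    case True
    then have "W t \<le> \<kappa> * exp (- nu * (0 - 0)) * W 0 + H"
      using step[of 0 0 "\<sigma> 0"] \<sigma> by (simp add: dwell_signals_def)
    then show ?thesis using mult_left_mono[OF W(2) \<kappa>(1)] by simp
  next
    case False
    then have "t > 0" using \<open>0 \<le> t\<close> by simp
    then obtain a where a: "0 \<le> a" "a < t" "a = 0 \<or> switch_at \<sigma> a"
      and between: "\<And>u. a < u \<Longrightarrow> u < t \<Longrightarrow> \<not> switch_at \<sigma> u"
      using last_switch_exists[OF \<sigma>] by blast
    have "W a \<le> L" using a at_switch[of a] W by (cases "a = 0") auto
    \<comment> \<open>The dwell time may not yet have elapsed at \<open>t\<close>, so the
      exponential is only bounded by one and \<open>\<kappa>\<close> stays in the bound.\<close>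
    then have "\<kappa> * exp (- nu * (t - a)) * W a \<le> \<kappa> * 1 * L"
      using \<kappa> W a \<open>0 \<le> nu\<close> by (intro mult_mono mult_left_mono) auto
    then show ?thesis using piece[OF a(1,2) between] by linarith
  qed
qed

section \<open>Uniform constants and the switched error system\<close>

lemma uniform_linear_bound:
  fixes L :: "'i \<Rightarrow> 'a::euclidean_space \<Rightarrow> 'b::real_normed_vector"
  assumes "finite I" and lin: "\<And>i. i \<in> I \<Longrightarrow> linear (L i)"
  obtains a where "a \<ge> 0" "\<And>i v. i \<in> I \<Longrightarrow> norm (L i v) \<le> a * norm v"
proof -
  define a where "a = (\<Sum>i\<in>I. onorm (L i))"
  have bl: "bounded_linear (L i)" if "i \<in> I" for i
    using lin[OF that] by (simp add: linear_conv_bounded_linear)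
  show thesis
  proof
    show "a \<ge> 0" unfolding a_def by (intro sum_nonneg onorm_pos_le bl)
    fix i v assume "i \<in> I"
    then have "onorm (L i) \<le> a"
      unfolding a_def using \<open>finite I\<close> by (intro member_le_sum onorm_pos_le bl) auto
    then show "norm (L i v) \<le> a * norm v"
      using onorm[OF bl[OF \<open>i \<in> I\<close>], of v] mult_right_mono[OF _ norm_ge_zero] order_trans by blast
  qed
qed

lemma err_norm_altdef: "err_norm m xs x = L2_set (\<lambda>i. norm (xs i - x)) {1..m}"
  by (simp add: err_norm_def L2_set_def)

lemma strongly_connected_consensus:
  fixes V :: "nat \<Rightarrow> 'a::euclidean_space set"
  assumes "m > 1" and E: "strongly_connected_sl m E"
    and V: "\<And>i. subspace (V i)" "(\<Inter>i\<in>{1..m}. V i) = {0}"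
  shows "projected_consensus {1..m} V (nbrs E)"
    and "\<exists>q r \<kappa>. contracting_consensus {1..m} V (nbrs E) q r \<kappa>"
proof -
  show "projected_consensus {1..m} V (nbrs E)"
    using \<open>m > 1\<close> E V(1) by unfold_locales (auto simp: strongly_connected_sl_def nbrs_def)
  then interpret projected_consensus "{1..m}" V "nbrs E" .
  have "{(j, i). j \<in> nbrs E i \<and> i \<in> {1..m}} = E"
    using E by (auto simp: strongly_connected_sl_def nbrs_def)
  then show "\<exists>q r \<kappa>. contracting_consensus {1..m} V (nbrs E) q r \<kappa>"
    using E by (intro contracting_norm_exists V(2)) (simp add: strongly_connected_sl_def)
qed

lemma uniform_contracting_consensus:
  fixes V :: "nat \<Rightarrow> 'a::euclidean_space set"
  assumes "m > 1" "finite P" and N: "\<forall>p\<in>P. strongly_connected_sl m (N p)"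
    and V: "\<And>i. subspace (V i)" "(\<Inter>i\<in>{1..m}. V i) = {0}"
  obtains r \<kappa> q where "r < 1" "1 \<le> \<kappa>"
    "\<And>p. p \<in> P \<Longrightarrow> contracting_consensus {1..m} V (nbrs (N p)) (q p) r \<kappa>"
proof -
  have "\<forall>p\<in>P. \<exists>q r \<kappa>. contracting_consensus {1..m} V (nbrs (N p)) q r \<kappa>"
    using strongly_connected_consensus(2)[OF \<open>m > 1\<close> _ V] N by blast
  then obtain q r \<kappa> where c: "\<And>p. p \<in> P \<Longrightarrow> contracting_consensus {1..m} V (nbrs (N p)) (q p) (r p) (\<kappa> p)"
    by metis
  \<comment> \<open>The inserted values \<open>1 / 2\<close> and, below, \<open>1\<close> give the
    maxima a meaning for empty \<open>P\<close> too.\<close>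
  define r' where "r' = Max (insert (1 / 2) (r ` P))"
  define \<kappa>' where "\<kappa>' = Max (insert 1 (\<kappa> ` P))"
  have "r' < 1"
    unfolding r'_def using \<open>finite P\<close> contracting_consensus.r(2)[OF c] by (subst Max_less_iff) auto
  moreover have "1 \<le> \<kappa>'" unfolding \<kappa>'_def using \<open>finite P\<close> by (intro Max_ge) auto
  moreover have "contracting_consensus {1..m} V (nbrs (N p)) (q p) r' \<kappa>'" if "p \<in> P" for p
  proof (rule projected_consensus.contracting_consensus_mono[OF _ c[OF that] _ \<open>r' < 1\<close>])
    show "projected_consensus {1..m} V (nbrs (N p))"
      using strongly_connected_consensus(1)[OF \<open>m > 1\<close> _ V] N that by blast
    show "r p \<le> r'" unfolding r'_def using \<open>finite P\<close> that by (intro Max_ge) auto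
    show "\<kappa> p \<le> \<kappa>'" unfolding \<kappa>'_def using \<open>finite P\<close> that by (intro Max_ge) auto
  qed
  ultimately show thesis using that by blast
qed

text \<open>The quantity tracked across switches uses the maximum norm, which all graphs share. On
  each interval it is exchanged for the norm of the active graph and back, at the cost of one factor
  \<open>\<kappa>\<close>.\<close>

lemma switched_consensus_decay:
  fixes V :: "nat \<Rightarrow> 'a::euclidean_space set" and e :: "nat \<Rightarrow> real \<Rightarrow> 'a"
  assumes V: "\<And>i. subspace (V i)"
    and c: "\<And>p. p \<in> P \<Longrightarrow> contracting_consensus {1..m} V (nbrs (N p)) (q p) r \<kappa>"
    and \<sigma>: "\<sigma> \<in> dwell_signals P \<tau>"
    and L: "\<And>i v. i \<in> {1..m} \<Longrightarrow> norm (L i v) \<le> a * norm v" and "0 \<le> a"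
    and cont: "\<And>i. i \<in> {1..m} \<Longrightarrow> continuous_on {0..} (e i)"
    and deriv: "\<And>i t. i \<in> {1..m} \<Longrightarrow> 0 \<le> t \<Longrightarrow> (e i has_vector_derivative
        (L i (e i t) - g *\<^sub>R orth_proj (V i) (e i t -
          (1 / real (card (nbrs (N (\<sigma> t)) i))) *\<^sub>R (\<Sum>j\<in>nbrs (N (\<sigma> t)) i. e j t)))) (at t within {t..})"
    and u: "\<And>i t. i \<in> {1..m} \<Longrightarrow> 0 \<le> t \<Longrightarrow> norm (e i t - orth_proj (V i) (e i t)) \<le> G * exp (- lam * t)"
    and e0: "\<And>i. i \<in> {1..m} \<Longrightarrow> norm (e i 0) \<le> E"
    and "0 < m" "0 \<le> G" "0 \<le> E" "0 < g" and rate: "lam + nu \<le> g * (1 - r) - \<kappa> * a" and "1 \<le> nu"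
    and dwell: "\<kappa> * exp (- nu * \<tau>) \<le> 1 / 2" and "1 \<le> \<kappa>" and "0 \<le> t"
  shows "exp (lam * t) * max_norm {1..m} (\<lambda>i. orth_proj (V i) (e i t)) \<le> \<kappa> * (E + 2 * (\<kappa> * ((a + g) * G))) + \<kappa> * ((a + g) * G)"
proof -
  define z where "z i t = orth_proj (V i) (e i t)" for i t
  define W where "W t = exp (lam * t) * max_norm {1..m} (\<lambda>i. z i t)" for t
  \<comment> \<open>The observable part, bounded by \<open>G * exp (- lam * t)\<close>, enters once
    through \<open>L i\<close>, with factor \<open>a\<close>, and once through the neighbours, with
    factor \<open>g\<close>.\<close>
  define F where "F = (a + g) * G"
  have "0 \<le> F" using \<open>0 \<le> a\<close> \<open>0 < g\<close> \<open>0 \<le> G\<close> by (simp add: F_def)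
  have I: "finite {1..m}" "{1..m} \<noteq> {}" using \<open>0 < m\<close> by auto
  \<comment> \<open>The level \<open>E + 2 * (\<kappa> * F)\<close> dominates both the initial value
    and twice the forcing, as the dwell-time argument requires.\<close>
  have "W t \<le> \<kappa> * (E + 2 * (\<kappa> * F)) + \<kappa> * F"
  proof (rule dwell_time_bound[OF \<sigma>, where W = W and nu = nu])
    fix t0 t1 p
    assume t: "0 \<le> t0" "t0 \<le> t1" and "p \<in> P" and p: "\<And>u. t0 \<le> u \<Longrightarrow> u < t1 \<Longrightarrow> \<sigma> u = p"
    interpret contracting_consensus "{1..m}" V "nbrs (N p)" "q p" r \<kappa> by (rule c[OF \<open>p \<in> P\<close>])
    define d where "d i t = orth_proj (V i) (L i (e i t)) + g *\<^sub>R S (\<lambda>j. e j t - z j t) i" for i t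
    have "exp (lam * t1) * q p (\<lambda>i. z i t1) \<le> exp (- nu * (t1 - t0)) * (exp (lam * t0) * q p (\<lambda>i. z i t0)) + \<kappa> * F / nu"
    proof (rule consensus_decay[OF t(2)])
      show "continuous_on {t0..t1} (z i)" if "i \<in> {1..m}" for i
        unfolding z_def using t linear_continuous_on[OF linear_orth_proj[OF V, unfolded linear_conv_bounded_linear], of UNIV]
        by (intro continuous_on_compose2[where f = "e i" and g = "orth_proj (V i)"] continuous_on_subset[OF cont[OF that]]) auto
      show "(z i has_vector_derivative (d i t - g *\<^sub>R (z i t - S (\<lambda>j. z j t) i))) (at t within {t..})"
        if "i \<in> {1..m}" "t0 \<le> t" "t < t1" for i t
        using projected_error_derivative[OF that(1), of e "L i (e i t)" g t] deriv[OF that(1), of t] p[OF that(2,3)] t that(2)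
        unfolding d_def z_def by simp
      show "norm (d i t) \<le> a * max_norm {1..m} (\<lambda>i. z i t) + F * exp (- lam * t)" if i: "i \<in> {1..m}" "t0 \<le> t" "t < t1" for t i
      proof -
        have "0 \<le> t" using t i by simp
        have "norm (e i t) \<le> norm (z i t) + norm (e i t - z i t)" using norm_triangle_sub by blast
        also have "\<dots> \<le> max_norm {1..m} (\<lambda>i. z i t) + G * exp (- lam * t)"
          using u[OF i(1) \<open>0 \<le> t\<close>] norm_le_max_norm[OF I(1) i(1), of "\<lambda>i. z i t"]
          by (simp add: z_def)
        finally have "a * norm (e i t) \<le> a * (max_norm {1..m} (\<lambda>i. z i t) + G * exp (- lam * t))"
          using \<open>0 \<le> a\<close> by (rule mult_left_mono)
        then have "norm (orth_proj (V i) (L i (e i t))) \<le> a * (max_norm {1..m} (\<lambda>i. z i t) + G * exp (- lam * t))"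
          using norm_orth_proj_le[OF V, of i "L i (e i t)"] L[OF i(1), of "e i t"] by linarith
        moreover have "norm (S (\<lambda>j. e j t - z j t) i) \<le> G * exp (- lam * t)"
        proof (rule order_trans[OF norm_S_le[OF i(1)]])
          show "max_norm {1..m} (\<lambda>j. e j t - z j t) \<le> G * exp (- lam * t)"
            unfolding max_norm_le_iff[OF I] z_def using u \<open>0 \<le> t\<close> by blast
        qed
        then have "norm (g *\<^sub>R S (\<lambda>j. e j t - z j t) i) \<le> g * (G * exp (- lam * t))"
          using \<open>0 < g\<close> by simp
        ultimately show ?thesis
          unfolding d_def F_def using norm_triangle_ineq[of "orth_proj (V i) (L i (e i t))" "g *\<^sub>R S (\<lambda>j. e j t - z j t) i"]
          by (simp add: algebra_simps)
      qed
    qed (use \<open>0 < g\<close> \<open>0 \<le> a\<close> \<open>0 \<le> F\<close> rate \<open>1 \<le> nu\<close> in auto)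
    moreover have "W t1 \<le> exp (lam * t1) * q p (\<lambda>i. z i t1)"
      unfolding W_def by (intro mult_left_mono q_lower) auto
    moreover have "exp (- nu * (t1 - t0)) * (exp (lam * t0) * q p (\<lambda>i. z i t0))
        \<le> exp (- nu * (t1 - t0)) * (exp (lam * t0) * (\<kappa> * max_norm {1..m} (\<lambda>i. z i t0)))"
      by (intro mult_left_mono q_upper) auto
    moreover have "\<kappa> * F / nu \<le> \<kappa> * F"
      using divide_left_mono[of 1 nu "\<kappa> * F"] \<open>1 \<le> \<kappa>\<close> \<open>0 \<le> F\<close> \<open>1 \<le> nu\<close> by simp
    ultimately have "W t1 \<le> exp (- nu * (t1 - t0)) * (exp (lam * t0) * (\<kappa> * max_norm {1..m} (\<lambda>i. z i t0))) + \<kappa> * F"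
      by linarith
    then show "W t1 \<le> \<kappa> * exp (- nu * (t1 - t0)) * W t0 + \<kappa> * F"
      by (simp add: W_def mult_ac)
  next
    show "0 \<le> W t" for t unfolding W_def by (intro mult_nonneg_nonneg max_norm_nonneg I) simp
    have "max_norm {1..m} (\<lambda>i. z i 0) \<le> E"
      unfolding z_def max_norm_le_iff[OF I] using order_trans[OF norm_orth_proj_le[OF V] e0] by blast
    moreover have "0 \<le> \<kappa> * F" using \<open>1 \<le> \<kappa>\<close> \<open>0 \<le> F\<close> by simp
    ultimately show "W 0 \<le> E + 2 * (\<kappa> * F)" by (simp add: W_def)
    show "2 * (\<kappa> * F) \<le> E + 2 * (\<kappa> * F)" using \<open>0 \<le> E\<close> by simp
  qed (use \<open>1 \<le> \<kappa>\<close> dwell \<open>1 \<le> nu\<close> \<open>0 \<le> t\<close> in auto)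
  then show ?thesis by (simp add: W_def z_def F_def)
qed

theorem theorem1:
  fixes A :: "real^'n^'n"
    and m :: nat
    and s :: "nat \<Rightarrow> nat"
    and C :: "nat \<Rightarrow> nat \<Rightarrow> real^'n"
    and P :: "'p set"
    and N :: "'p \<Rightarrow> (nat \<times> nat) set"
    and \<tau>D lam :: real
  assumes "m > 1"
    and joint_obs: "(\<Inter>i\<in>{1..m}. unobs A (C i) (s i)) = {0}"
    and "finite P"
    and graphs: "\<forall>p\<in>P. strongly_connected_sl m (N p)"
    and "\<tau>D > 0" and "lam > 0"
  shows "\<exists>K :: nat \<Rightarrow> nat \<Rightarrow> real^'n. \<exists>g0>0. \<forall>g\<ge>g0. \<exists>c>0.
    \<forall>\<sigma>\<in>dwell_signals P \<tau>D. \<forall>(x :: real \<Rightarrow> real^'n) (xs :: nat \<Rightarrow> real \<Rightarrow> real^'n).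
      continuous_on {0..} x \<and> (\<forall>i\<in>{1..m}. continuous_on {0..} (xs i)) \<and>
      (\<forall>t\<ge>0. (x has_vector_derivative (A *v x t)) (at t within {t..})) \<and>
      (\<forall>i\<in>{1..m}. \<forall>t\<ge>0. (xs i has_vector_derivative
          (A *v xs i t + gain (K i) (s i) (outp (C i) (s i) (xs i t))
           - gain (K i) (s i) (outp (C i) (s i) (x t))
           - g *\<^sub>R orth_proj (unobs A (C i) (s i))
               (xs i t - (1 / real (card (nbrs (N (\<sigma> t)) i))) *\<^sub>R
                  (\<Sum>j\<in>nbrs (N (\<sigma> t)) i. xs j t))))
        (at t within {t..}))
      \<longrightarrow> (\<forall>t\<ge>0. err_norm m (\<lambda>i. xs i t) (x t) \<le> c * exp (- lam * t) * err_norm m (\<lambda>i. xs i 0) (x 0))"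
proof -
  define V where "V i = unobs A (C i) (s i)" for i
  have V: "subspace (V i)" for i by (simp add: V_def subspace_unobs)
  have "\<forall>i. \<exists>K b. b \<ge> 0 \<and> (\<forall>e d. continuous_on {0..} e \<longrightarrow> (\<forall>t\<ge>0. d t \<in> V i) \<longrightarrow>
      (\<forall>t\<ge>0. (e has_vector_derivative (A *v e t + gain K (s i) (outp (C i) (s i) (e t)) + d t)) (at t within {t..})) \<longrightarrow>
      (\<forall>t\<ge>0. norm (e t - orth_proj (V i) (e t)) \<le> b * exp (- lam * t) * norm (e 0)))"
    unfolding V_def using observable_error_decay by blast
  from choice[OF this] obtain K where "\<forall>i. \<exists>b. b \<ge> 0 \<and> (\<forall>e d. continuous_on {0..} e \<longrightarrow> (\<forall>t\<ge>0. d t \<in> V i) \<longrightarrow>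
      (\<forall>t\<ge>0. (e has_vector_derivative (A *v e t + gain (K i) (s i) (outp (C i) (s i) (e t)) + d t)) (at t within {t..})) \<longrightarrow>
      (\<forall>t\<ge>0. norm (e t - orth_proj (V i) (e t)) \<le> b * exp (- lam * t) * norm (e 0)))" ..
  from choice[OF this] obtain b where Kb: "\<forall>i. b i \<ge> 0 \<and> (\<forall>e d. continuous_on {0..} e \<longrightarrow> (\<forall>t\<ge>0. d t \<in> V i) \<longrightarrow>
      (\<forall>t\<ge>0. (e has_vector_derivative (A *v e t + gain (K i) (s i) (outp (C i) (s i) (e t)) + d t)) (at t within {t..})) \<longrightarrow>
      (\<forall>t\<ge>0. norm (e t - orth_proj (V i) (e t)) \<le> b i * exp (- lam * t) * norm (e 0)))" ..
  note b = Kb[THEN spec, THEN conjunct1] and u_decay = Kb[THEN spec, THEN conjunct2, rule_format]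
  define L where "L i v = A *v v + gain (K i) (s i) (outp (C i) (s i) v)" for i v
  have linL: "linear (L i)" for i
    unfolding L_def[abs_def] by (rule linear_compose_add[OF matrix_vector_mul_linear linear_gain_outp])
  obtain a where "a \<ge> 0" and a: "\<And>i v. i \<in> {1..m} \<Longrightarrow> norm (L i v) \<le> a * norm v"
    using uniform_linear_bound[of "{1..m}" L] linL by blast
  obtain r \<kappa> q where "r < 1" "1 \<le> \<kappa>"
    and c: "\<And>p. p \<in> P \<Longrightarrow> contracting_consensus {1..m} V (nbrs (N p)) (q p) r \<kappa>"
    using uniform_contracting_consensus[OF \<open>m > 1\<close> \<open>finite P\<close> graphs V joint_obs[folded V_def]] by blast
  \<comment> \<open>The logarithm makes one dwell time shrink by \<open>2 * \<kappa>\<close>; the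
    lower bound \<open>1\<close> allows the division by \<open>nu\<close> in the forcing term to be
    dropped.\<close>
  define nu where "nu = max 1 (ln (2 * \<kappa>) / \<tau>D)"
  have "1 \<le> nu" by (simp add: nu_def)
  have dwell: "\<kappa> * exp (- nu * \<tau>D) \<le> 1 / 2"
  proof -
    have "ln (2 * \<kappa>) / \<tau>D \<le> nu" by (simp add: nu_def)
    then have "ln (2 * \<kappa>) \<le> nu * \<tau>D" using \<open>\<tau>D > 0\<close> by (simp add: divide_le_eq)
    then have "2 * \<kappa> \<le> exp (nu * \<tau>D)" using \<open>1 \<le> \<kappa>\<close> exp_le_cancel_iff[of "ln (2 * \<kappa>)" "nu * \<tau>D"] by simp
    then show ?thesis by (simp add: exp_minus field_simps)
  qed
  \<comment> \<open>The rate condition of the consensus estimate, solved for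
    \<open>g\<close>.\<close>
  define g0 where "g0 = (lam + nu + \<kappa> * a) / (1 - r)"
  have "g0 > 0"
    unfolding g0_def using \<open>lam > 0\<close> \<open>1 \<le> nu\<close> \<open>1 \<le> \<kappa>\<close> \<open>a \<ge> 0\<close> \<open>r < 1\<close>
    by (intro divide_pos_pos add_pos_nonneg) auto
  define \<gamma> where "\<gamma> = (\<Sum>i\<in>{1..m}. b i)"
  have "0 \<le> \<gamma>" unfolding \<gamma>_def by (intro sum_nonneg b)
  have b_le: "b i \<le> \<gamma>" if "i \<in> {1..m}" for i
    unfolding \<gamma>_def using b that by (intro member_le_sum) auto
  show ?thesis
  proof (rule exI[of _ K], rule exI[of _ g0], intro conjI allI impI)
    fix g assume "g0 \<le> g"
    then have "0 < g" using \<open>g0 > 0\<close> by simp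
    have rate: "lam + nu \<le> g * (1 - r) - \<kappa> * a"
      using \<open>g0 \<le> g\<close> \<open>r < 1\<close> by (simp add: g0_def divide_le_eq)
    \<comment> \<open>With \<open>G = \<gamma> * E\<close>, the bound on the unobservable components
      is linear in \<open>E\<close>. Its coefficient is taken, plus \<open>\<gamma>\<close> for the
      observable part.\<close>
    define c1 where "c1 = \<kappa> * (1 + 2 * (\<kappa> * ((a + g) * \<gamma>))) + \<kappa> * ((a + g) * \<gamma>) + \<gamma>"
    have "c1 > 0"
      unfolding c1_def using \<open>1 \<le> \<kappa>\<close> \<open>a \<ge> 0\<close> \<open>0 < g\<close> \<open>0 \<le> \<gamma>\<close>
      by (intro add_pos_nonneg mult_pos_pos) auto
    show "\<exists>c>0. \<forall>\<sigma>\<in>dwell_signals P \<tau>D. \<forall>(x :: real \<Rightarrow> real^'n) (xs :: nat \<Rightarrow> real \<Rightarrow> real^'n).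
      continuous_on {0..} x \<and> (\<forall>i\<in>{1..m}. continuous_on {0..} (xs i)) \<and>
      (\<forall>t\<ge>0. (x has_vector_derivative (A *v x t)) (at t within {t..})) \<and>
      (\<forall>i\<in>{1..m}. \<forall>t\<ge>0. (xs i has_vector_derivative
          (A *v xs i t + gain (K i) (s i) (outp (C i) (s i) (xs i t))
           - gain (K i) (s i) (outp (C i) (s i) (x t))
           - g *\<^sub>R orth_proj (unobs A (C i) (s i))
               (xs i t - (1 / real (card (nbrs (N (\<sigma> t)) i))) *\<^sub>R
                  (\<Sum>j\<in>nbrs (N (\<sigma> t)) i. xs j t))))
        (at t within {t..}))
      \<longrightarrow> (\<forall>t\<ge>0. err_norm m (\<lambda>i. xs i t) (x t) \<le> c * exp (- lam * t) * err_norm m (\<lambda>i. xs i 0) (x 0))"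
    proof (intro exI[of _ "real m * c1"] conjI ballI allI impI; (elim conjE)?)
      show "0 < real m * c1" using \<open>c1 > 0\<close> \<open>m > 1\<close> by simp
      fix \<sigma> and x :: "real \<Rightarrow> real^'n" and xs :: "nat \<Rightarrow> real \<Rightarrow> real^'n" and t :: real
      assume \<sigma>: "\<sigma> \<in> dwell_signals P \<tau>D" and "0 \<le> t"
        and cont: "continuous_on {0..} x" "\<forall>i\<in>{1..m}. continuous_on {0..} (xs i)"
        and dx: "\<forall>t\<ge>0. (x has_vector_derivative (A *v x t)) (at t within {t..})"
        and dxs: "\<forall>i\<in>{1..m}. \<forall>t\<ge>0. (xs i has_vector_derivative
          (A *v xs i t + gain (K i) (s i) (outp (C i) (s i) (xs i t))
           - gain (K i) (s i) (outp (C i) (s i) (x t))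
           - g *\<^sub>R orth_proj (unobs A (C i) (s i))
               (xs i t - (1 / real (card (nbrs (N (\<sigma> t)) i))) *\<^sub>R
                  (\<Sum>j\<in>nbrs (N (\<sigma> t)) i. xs j t)))) (at t within {t..})"
      define e where "e i t = xs i t - x t" for i t
      define E where "E = err_norm m (\<lambda>i. xs i 0) (x 0)"
      have e0: "norm (e i 0) \<le> E" if "i \<in> {1..m}" for i
        unfolding E_def err_norm_altdef e_def
        using member_le_L2_set[OF _ that, of "\<lambda>i. norm (xs i 0 - x 0)"] by simp
      have "0 \<le> E" by (simp add: E_def err_norm_altdef)
      have cont_e: "continuous_on {0..} (e i)" if "i \<in> {1..m}" for i
        unfolding e_def using cont that by (intro continuous_on_diff) auto
      have de: "(e i has_vector_derivative
          (L i (e i t) - g *\<^sub>R orth_proj (V i) (e i t -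
            (1 / real (card (nbrs (N (\<sigma> t)) i))) *\<^sub>R (\<Sum>j\<in>nbrs (N (\<sigma> t)) i. e j t)))) (at t within {t..})"
        if i: "i \<in> {1..m}" and "0 \<le> t" for i t
      proof -
        have "\<sigma> t \<in> P" using \<sigma> \<open>0 \<le> t\<close> by (simp add: dwell_signals_def)
        then interpret projected_consensus "{1..m}" V "nbrs (N (\<sigma> t))"
          using strongly_connected_consensus(1)[OF \<open>m > 1\<close> _ V joint_obs[folded V_def]] graphs by blast
        define k where "k = card (nbrs (N (\<sigma> t)) i)"
        have "k > 0" using Nb_finite[OF i] by (simp add: k_def)
        \<comment> \<open>The weights sum to one, as the neighbour set is nonempty, so the true
          state cancels and the consensus term depends on the errors alone.\<close>
        have avg: "(1 / real k) *\<^sub>R (\<Sum>j\<in>nbrs (N (\<sigma> t)) i. e j t)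
            = (1 / real k) *\<^sub>R (\<Sum>j\<in>nbrs (N (\<sigma> t)) i. xs j t) - x t"
          using \<open>k > 0\<close> by (simp add: e_def sum_subtractf scaleR_diff_right sum_constant_scaleR k_def del: sum_constant)
        have "gain (K i) (s i) (outp (C i) (s i) (e i t))
            = gain (K i) (s i) (outp (C i) (s i) (xs i t)) - gain (K i) (s i) (outp (C i) (s i) (x t))"
          unfolding e_def by (rule linear_diff[OF linear_gain_outp])
        then have "A *v xs i t + gain (K i) (s i) (outp (C i) (s i) (xs i t))
           - gain (K i) (s i) (outp (C i) (s i) (x t)) - A *v x t = L i (e i t)"
          by (simp add: L_def e_def matrix_vector_mult_diff_distrib)
        then have rhs: "A *v xs i t + gain (K i) (s i) (outp (C i) (s i) (xs i t))
           - gain (K i) (s i) (outp (C i) (s i) (x t)) - w - A *v x t = L i (e i t) - w" for w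
          by (simp add: algebra_simps)
        have "xs i t - (1 / real k) *\<^sub>R (\<Sum>j\<in>nbrs (N (\<sigma> t)) i. xs j t)
            = e i t - (1 / real k) *\<^sub>R (\<Sum>j\<in>nbrs (N (\<sigma> t)) i. e j t)"
          unfolding avg by (simp add: e_def)
        then show ?thesis
          using has_vector_derivative_diff[OF dxs[rule_format, OF i \<open>0 \<le> t\<close>] dx[rule_format, OF \<open>0 \<le> t\<close>]]
          unfolding rhs e_def[abs_def, symmetric] V_def[symmetric] k_def[symmetric]
          by (simp only: e_def[abs_def])
      qed
      have u: "norm (e i t - orth_proj (V i) (e i t)) \<le> \<gamma> * E * exp (- lam * t)"
        if i: "i \<in> {1..m}" and "0 \<le> t" for i t
      proof -
        \<comment> \<open>The whole consensus term is a disturbance inside \<open>V i\<close>, to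
          which the estimate for the observable part is blind.\<close>
        define d where "d t = - (g *\<^sub>R orth_proj (V i) (e i t -
            (1 / real (card (nbrs (N (\<sigma> t)) i))) *\<^sub>R (\<Sum>j\<in>nbrs (N (\<sigma> t)) i. e j t)))" for t
        have "norm (e i t - orth_proj (V i) (e i t)) \<le> b i * exp (- lam * t) * norm (e i 0)"
        proof (rule u_decay[OF cont_e[OF i] _ _ \<open>0 \<le> t\<close>])
          show "d t \<in> V i" for t
            unfolding d_def by (simp add: orth_proj_mem V subspace_neg subspace_scale)
          show "(e i has_vector_derivative (A *v e i t + gain (K i) (s i) (outp (C i) (s i) (e i t)) + d t))
              (at t within {t..})" if "0 \<le> t" for t
            using de[OF i that] by (simp add: d_def L_def)
        qed
        also have "\<dots> \<le> \<gamma> * exp (- lam * t) * E"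
          using b_le[OF i] e0[OF i] b[of i] \<open>0 \<le> \<gamma>\<close> by (intro mult_mono mult_right_mono) auto
        finally show ?thesis by (simp add: mult_ac)
      qed
      have z: "exp (lam * t) * max_norm {1..m} (\<lambda>i. orth_proj (V i) (e i t))
          \<le> \<kappa> * (E + 2 * (\<kappa> * ((a + g) * (\<gamma> * E)))) + \<kappa> * ((a + g) * (\<gamma> * E))"
        using \<open>m > 1\<close> \<open>0 \<le> \<gamma>\<close> \<open>0 \<le> E\<close>
        by (intro switched_consensus_decay[OF V c \<sigma> a \<open>a \<ge> 0\<close> cont_e de u e0 _ _ _ \<open>0 < g\<close> rate \<open>1 \<le> nu\<close> dwell \<open>1 \<le> \<kappa>\<close> \<open>0 \<le> t\<close>])
          auto
      have e_le: "norm (e i t) \<le> c1 * exp (- lam * t) * E" if i: "i \<in> {1..m}" for i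
      proof -
        have "exp (lam * t) * norm (orth_proj (V i) (e i t)) \<le> \<kappa> * (E + 2 * (\<kappa> * ((a + g) * (\<gamma> * E)))) + \<kappa> * ((a + g) * (\<gamma> * E))"
          using order_trans[OF mult_left_mono[OF norm_le_max_norm[OF _ i, of "\<lambda>i. orth_proj (V i) (e i t)"]] z] by simp
        also have "\<dots> = (c1 - \<gamma>) * E" by (simp add: c1_def algebra_simps)
        finally have "exp (- lam * t) * (exp (lam * t) * norm (orth_proj (V i) (e i t))) \<le> exp (- lam * t) * ((c1 - \<gamma>) * E)"
          by (rule mult_left_mono) simp
        moreover have "exp (- lam * t) * (exp (lam * t) * y) = y" for y
          by (simp add: exp_minus)
        ultimately have "norm (orth_proj (V i) (e i t)) \<le> exp (- lam * t) * ((c1 - \<gamma>) * E)"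
          by (simp only:)
        then show ?thesis
          using u[OF i \<open>0 \<le> t\<close>] norm_triangle_sub[of "e i t" "orth_proj (V i) (e i t)"]
          by (simp add: algebra_simps)
      qed
      have "err_norm m (\<lambda>i. xs i t) (x t) \<le> (\<Sum>i\<in>{1..m}. norm (e i t))"
        unfolding err_norm_altdef e_def by (rule L2_set_le_sum) simp
      also have "\<dots> \<le> (\<Sum>i\<in>{1..m}. c1 * exp (- lam * t) * E)" by (intro sum_mono e_le)
      also have "\<dots> = real m * c1 * exp (- lam * t) * E" by simp
      finally show "err_norm m (\<lambda>i. xs i t) (x t) \<le> real m * c1 * exp (- lam * t) * err_norm m (\<lambda>i. xs i 0) (x 0)"
        unfolding E_def .
    qed
  qed (rule \<open>g0 > 0\<close>)
qed

end
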